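(* For $\lambda>0$ let $$S_*(\lambda)=-\frac{1}{\pi}\int_{-\infty}^\infty\int_{-\infty}^\infty\frac{e^{i\lambda x}}{1+e^{x^2+y^2}}\,dx\,dy .$$ Then, as $\lambda\to+\infty$, $$S_*(\lambda)\;\sim\;2^{3/2}\pi^{1/4}\,e^{-\lambda\sqrt{\pi/2}}\;\frac{\cos\left(\lambda\sqrt{\pi/2}+\pi/8\right)}{\lambda^{1/2}},$$ in the sense that $$S_*(\lambda)-2^{3/2}\pi^{1/4}\,e^{-\lambda\sqrt{\pi/2}}\;\frac{\cos\left(\lambda\sqrt{\pi/2}+\pi/8\right)}{\lambda^{1/2}}=o\left(\lambda^{-1/2}e^{-\lambda\sqrt{\pi/2}}\right)\qquad(\lambda\to+\infty).$$
   Context: The symbol $\sim$ with an oscillating right-hand side means that the error is of smaller order of magnitude than the non-oscillating amplitude factor of the right-hand side (here $\lambda^{-1/2}e^{-\lambda\sqrt{\pi/2}}$). With the convention $\hat F(\xi,\eta)=\int_{\mathbb{R}^2}F(x,y)e^{-ix\xi-iy\eta}\,dx\,dy$, one has $S_*(\lambda)=-\frac1\pi\hat F(-\lambda,0)$ for the radial function $F(x,y)=(1+e^{x^2+y^2})^{-1}$. *)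

theory Defs
  imports "HOL-Analysis.Analysis" "HOL-Library.Landau_Symbols"
begin

definition S_star :: "real \<Rightarrow> complex" where
  "S_star l = - (1 / of_real pi) *
     (\<integral>y. (\<integral>x. exp (\<i> * of_real (l * x)) / of_real (1 + exp (x\<^sup>2 + y\<^sup>2)) \<partial>lborel) \<partial>lborel)"

end

theory Submission
  imports Defs "HOL-Complex_Analysis.Complex_Analysis" "HOL-Probability.Sinc_Integral"
    "HOL-Real_Asymp.Real_Asymp"
begin

text \<open>The exponential rate and the oscillation come from the poles of the Fermi function \<open>1 / (1 + exp z)\<close> at
\<open>z = \<plusminus> \<i> \<pi>\<close>, seen through \<open>z = x\<^sup>2 + y\<^sup>2\<close>: for fixed \<open>y\<close> they sit at \<open>x = \<i> a\<close> with \<open>a\<^sup>2 = y\<^sup>2 \<plusminus> \<i> \<pi>\<close>, and their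
height \<open>Re a\<close> is least for \<open>y = 0\<close>, where it is \<open>sqrt (\<pi> / 2)\<close>.

To isolate these poles, write (\<open>fermi_function_remainder\<close>)
\<open>1 / (1 + exp z) = H z - 1 / (z - \<i> \<pi>) - 1 / (z + \<i> \<pi>) + 2 / (z + 4)\<close>, where \<open>H\<close> is holomorphic on the
image of the strip \<open>0 \<le> Im x \<le> 3/2\<close> and bounded there by a multiple of \<open>1 / |z + 4|\<^sup>2\<close>. Shifting the \<open>x\<close>-integral of \<open>H\<close>
to \<open>Im x = 3/2\<close> (\<open>integral_horizontal_shift\<close>) makes its contribution \<open>O(exp (- 3/2 \<lambda>))\<close>, which is negligible. For
the remaining fractions the \<open>x\<close>-integral is exact (\<open>fourier_inverse_square_plus_square\<close>):
\<open>\<integral> exp (\<i> \<lambda> x) / (x\<^sup>2 + a\<^sup>2) dx = \<pi> exp (- \<lambda> a) / a\<close> for \<open>Re a > 0\<close>.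

Thus \<open>S\<^sub>*(\<lambda>)\<close> is, up to a negligible error, a combination of the integrals \<open>M b \<lambda> = \<integral> exp (- \<lambda> a(y)) / a(y) dy\<close> with
\<open>a(y) = csqrt (y\<^sup>2 + b\<^sup>2)\<close> (\<open>S_star_bessel\<close>), for \<open>b\<^sup>2 = \<plusminus> \<i> \<pi>\<close> and for \<open>b = 2\<close>. Laplace's method at \<open>y = 0\<close>
(\<open>laplace_asymptotics\<close>), which ends in a Gaussian integral with complex variance, shows that \<open>M b \<lambda>\<close> is asymptotic to
\<open>csqrt (2 \<pi> / (\<lambda> b)) exp (- \<lambda> b)\<close>. So \<open>b = 2\<close> is negligible, because \<open>2 > sqrt (\<pi> / 2)\<close>, and the two conjugate values
\<open>b = sqrt \<pi> exp (\<plusminus> \<i> \<pi> / 4)\<close> add up to the cosine, the phase \<open>\<pi> / 8\<close> being half the argument of \<open>b\<close>.\<close>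

section \<open>Integrals along horizontal lines\<close>

lemma integrable_inverse_one_plus_square: "integrable lborel (\<lambda>x::real. C / (1 + x\<^sup>2))"
proof -
  have "integrable lborel (\<lambda>x::real. inverse (1 + x\<^sup>2))"
    using integrable_inverse_1_plus_square by (simp add: set_integrable_def)
  then have "integrable lborel (\<lambda>x::real. C * inverse (1 + x\<^sup>2))"
    by (rule integrable_mult_right)
  then show ?thesis by (simp add: field_simps)
qed

lemma integrable_dominated_by_inverse_square:
  fixes f :: "real \<Rightarrow> complex"
  assumes "f \<in> borel_measurable borel" "\<And>x. norm (f x) \<le> C / (1 + x\<^sup>2)"
  shows "integrable lborel f"
proof (rule Bochner_Integration.integrable_bound[OF integrable_inverse_one_plus_square[of C]])
  show "AE x in lborel. norm (f x) \<le> norm (C / (1 + x\<^sup>2))"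
    by (intro AE_I2 order_trans[OF assms(2)]) (simp add: divide_right_mono)
qed (use assms in auto)

text \<open>The integrals over the real line below (shifted contours, a rational function, Gaussians along
rotated rays) are read off from primitives through this limit. The symmetric difference is what lets
the ends at plus and minus infinity be compared without knowing limits of the primitive itself.\<close>

lemma FTC_symmetric_limit:
  fixes G g :: "real \<Rightarrow> complex"
  assumes deriv: "\<And>x. (G has_vector_derivative g x) (at x)"
    and cont: "continuous_on UNIV g" and int: "integrable lborel g"
  shows "((\<lambda>R. G R - G (- R)) \<longlongrightarrow> (\<integral>x. g x \<partial>lborel)) at_top"
proof -
  have g_meas: "g \<in> borel_measurable borel"
    using cont by (rule borel_measurable_continuous_onI)
  have "((\<lambda>R. \<integral>x. indicator {-R..R} x *\<^sub>R g x \<partial>lborel) \<longlongrightarrow> (\<integral>x. g x \<partial>lborel)) at_top"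
  proof (rule integral_dominated_convergence_at_top)
    show "AE x in lborel. ((\<lambda>R. indicator {-R..R} x *\<^sub>R g x) \<longlongrightarrow> g x) at_top"
    proof (rule AE_I2)
      fix x :: real
      have "\<forall>\<^sub>F R in at_top. indicator {-R..R} x *\<^sub>R g x = g x"
        using eventually_ge_at_top[of "\<bar>x\<bar>"] by eventually_elim (auto simp: indicator_def)
      then show "((\<lambda>R. indicator {-R..R} x *\<^sub>R g x) \<longlongrightarrow> g x) at_top"
        by (rule tendsto_eventually)
    qed
    show "integrable lborel (\<lambda>x. norm (g x))" using int by simp
    show "\<forall>\<^sub>F R in at_top. AE x in lborel. norm (indicator {-R..R} x *\<^sub>R g x) \<le> norm (g x)"
      by (auto simp: indicator_def)
  qed (use g_meas in auto)
  moreover have "\<forall>\<^sub>F R in at_top. (\<integral>x. indicator {-R..R} x *\<^sub>R g x \<partial>lborel) = G R - G (- R)"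
    using eventually_ge_at_top[of 0]
  proof eventually_elim
    case (elim R)
    show ?case
      by (rule integral_FTC_Icc)
         (use elim deriv cont in \<open>auto intro: has_vector_derivative_at_within continuous_on_subset\<close>)
  qed
  ultimately show ?thesis
    using tendsto_cong by fast
qed

lemma continuous_on_horizontal_line:
  assumes "f holomorphic_on S" "open S" "\<And>x. Complex x b \<in> S"
  shows "continuous_on UNIV (\<lambda>x. f (Complex x b))"
proof -
  have "continuous_on (range (\<lambda>x. Complex x b)) f"
    using assms by (intro continuous_on_subset[OF holomorphic_on_imp_continuous_on]) auto
  then show ?thesis
    by (rule continuous_on_compose2) (auto intro!: continuous_intros simp: Complex_eq)
qed

text \<open>On a convex domain there is a primitive, so no contour is needed: the difference of the two
integrals over a bounded interval is the difference of the increments of the primitive along the two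
vertical sides, and these tend to zero by the decay of the integrand.\<close>

lemma integral_horizontal_shift:
  assumes S: "open S" "convex S" "\<And>w. 0 \<le> Im w \<Longrightarrow> Im w \<le> B \<Longrightarrow> w \<in> S"
    and B: "0 \<le> B" and holo: "f holomorphic_on S"
    and bound: "\<And>x b. 0 \<le> b \<Longrightarrow> b \<le> B \<Longrightarrow> norm (f (Complex x b)) \<le> C / (1 + x\<^sup>2)"
  shows "integrable lborel (\<lambda>x. f (of_real x))"
    and "(\<integral>x. f (of_real x) \<partial>lborel) = (\<integral>x. f (Complex x B) \<partial>lborel)"
proof -
  have cont: "continuous_on UNIV (\<lambda>x. f (Complex x b))" if "0 \<le> b" "b \<le> B" for b
    using holo S(1) by (rule continuous_on_horizontal_line) (use that S(3) in auto)
  have int: "integrable lborel (\<lambda>x. f (Complex x b))" if "0 \<le> b" "b \<le> B" for b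
    using bound[OF that] cont[OF that]
    by (intro integrable_dominated_by_inverse_square[of _ C] borel_measurable_continuous_onI) auto
  obtain G where G0: "\<And>w. w \<in> S \<Longrightarrow> (G has_field_derivative f w) (at w within S)"
    by (rule holomorphic_convex_primitive'[OF S(2,1) holo]) (rule that)
  have G: "(G has_field_derivative f w) (at w)" if "w \<in> S" for w
    using G0[OF that] unfolding at_within_open[OF that S(1)] .
  have deriv: "((\<lambda>x. G (Complex x b)) has_vector_derivative f (Complex x b)) (at x)"
    if "0 \<le> b" "b \<le> B" for x b
  proof -
    have 1: "((\<lambda>x. Complex x b) has_vector_derivative 1) (at x)"
      unfolding Complex_eq by (auto intro!: derivative_eq_intros)
    have "Complex x b \<in> S" using that S(3) by simp
    from field_vector_diff_chain_at[OF 1 G[OF this]] show ?thesis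
      by (simp add: o_def)
  qed
  let ?side = "\<lambda>x. G (Complex x B) - G (Complex x 0)"
  have side_bound: "norm (?side x) \<le> C / (1 + x\<^sup>2) * B" for x
  proof -
    have seg: "w \<in> S \<and> norm (f w) \<le> C / (1 + x\<^sup>2)"
      if "w \<in> closed_segment (Complex x B) (Complex x 0)" for w
    proof -
      from that B have w: "w = Complex x (Im w)" "0 \<le> Im w" "Im w \<le> B"
        by (auto simp: closed_segment_same_Re closed_segment_eq_real_ivl complex_eq_iff split: if_splits)
      show ?thesis using bound[OF w(2,3)] S(3) w(2,3) by (metis w(1))
    qed
    have "norm (?side x) \<le> C / (1 + x\<^sup>2) * norm (Complex x B - Complex x 0)"
      by (rule field_differentiable_bound[of "closed_segment (Complex x B) (Complex x 0)" G f])
         (use seg G in \<open>auto intro: has_field_derivative_at_within\<close>)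
    also have "norm (Complex x B - Complex x 0) = B"
      using B by (simp add: cmod_def)
    finally show ?thesis .
  qed
  have side: "(?side \<longlongrightarrow> 0) at_top" "((\<lambda>x. ?side (- x)) \<longlongrightarrow> 0) at_top"
  proof -
    have lim: "((\<lambda>x. C / (1 + x\<^sup>2) * B) \<longlongrightarrow> 0) at_top" by real_asymp
    show "(?side \<longlongrightarrow> 0) at_top"
      by (rule Lim_null_comparison[OF _ lim]) (use side_bound in simp)
    show "((\<lambda>x. ?side (- x)) \<longlongrightarrow> 0) at_top"
      by (rule Lim_null_comparison[OF _ lim]) (use side_bound[of "- x" for x] in simp)
  qed
  have "(\<integral>x. f (Complex x B) - f (Complex x 0) \<partial>lborel) = 0 - 0"
  proof (rule tendsto_unique[OF _ FTC_symmetric_limit])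
    show "(?side has_vector_derivative f (Complex x B) - f (Complex x 0)) (at x)" for x
      using deriv[of B x] deriv[of 0 x] B by (intro has_vector_derivative_diff) auto
    show "((\<lambda>x. ?side x - ?side (- x)) \<longlongrightarrow> 0 - 0) at_top"
      by (intro tendsto_diff side)
  qed (use cont int B in \<open>auto intro!: continuous_on_diff\<close>)
  moreover have "(\<integral>x. f (Complex x B) - f (Complex x 0) \<partial>lborel)
      = (\<integral>x. f (Complex x B) \<partial>lborel) - (\<integral>x. f (Complex x 0) \<partial>lborel)"
    using int B by (intro Bochner_Integration.integral_diff) auto
  ultimately show "(\<integral>x. f (of_real x) \<partial>lborel) = (\<integral>x. f (Complex x B) \<partial>lborel)"
    by (simp add: complex_of_real_def)
  show "integrable lborel (\<lambda>x. f (of_real x))"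
    using int[of 0] B by (simp add: complex_of_real_def)
qed

section \<open>The Fourier transform of a simple fraction\<close>

text \<open>The decay hypothesis of the contour shift has to hold on the whole strip, but only the tails can be
estimated by hand: near a removable singularity there is no formula to estimate, and compactness
takes over.\<close>

lemma strip_bound_from_tails:
  fixes f :: "complex \<Rightarrow> complex"
  assumes cont: "continuous_on {w. 0 \<le> Im w \<and> Im w \<le> B} f"
    and tails: "\<And>w. 0 \<le> Im w \<Longrightarrow> Im w \<le> B \<Longrightarrow> M \<le> \<bar>Re w\<bar> \<Longrightarrow> norm (f w) \<le> C / (1 + (Re w)\<^sup>2)"
  obtains C' where "\<And>x b. 0 \<le> b \<Longrightarrow> b \<le> B \<Longrightarrow> norm (f (Complex x b)) \<le> C' / (1 + x\<^sup>2)"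
proof -
  let ?K = "cbox (Complex (- M) 0) (Complex M B)"
  have "compact ((\<lambda>w. of_real (1 + (Re w)\<^sup>2) * f w) ` ?K)"
    by (intro compact_continuous_image continuous_intros continuous_on_subset[OF cont])
       (auto simp: in_cbox_complex_iff)
  then obtain D where "\<forall>z \<in> (\<lambda>w. of_real (1 + (Re w)\<^sup>2) * f w) ` ?K. norm z \<le> D"
    using compact_imp_bounded bounded_iff by blast
  then have D: "norm (of_real (1 + (Re w)\<^sup>2) * f w) \<le> D" if "w \<in> ?K" for w
    using that by blast
  have pos: "0 < 1 + x\<^sup>2" for x :: real
    by (simp add: add_pos_nonneg)
  show thesis
  proof (rule that[of "max C D"])
    fix x b :: real
    assume b: "0 \<le> b" "b \<le> B"
    show "norm (f (Complex x b)) \<le> max C D / (1 + x\<^sup>2)"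
    proof (cases "M \<le> \<bar>x\<bar>")
      case True
      have "norm (f (Complex x b)) \<le> C / (1 + x\<^sup>2)"
        using tails[of "Complex x b"] b True by simp
      also have "\<dots> \<le> max C D / (1 + x\<^sup>2)"
        using pos[of x] by (intro divide_right_mono) auto
      finally show ?thesis .
    next
      case False
      then have "Complex x b \<in> ?K" using b by (auto simp: in_cbox_complex_iff)
      from D[OF this] have "(1 + x\<^sup>2) * norm (f (Complex x b)) \<le> D"
        using pos[of x] by (simp add: norm_mult del: of_real_add of_real_power)
      then have "(1 + x\<^sup>2) * norm (f (Complex x b)) \<le> max C D" by simp
      then show ?thesis using pos[of x] by (simp add: field_simps)
    qed
  qed
qed

lemma norm_square_plus_square_ge:
  assumes "1 + 2 * norm a \<le> \<bar>Re w\<bar>"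
  shows "(1 + (Re w)\<^sup>2) / 2 \<le> norm (w\<^sup>2 + a\<^sup>2)"
proof -
  have "(1 + 2 * norm a)\<^sup>2 \<le> \<bar>Re w\<bar>\<^sup>2"
    using assms by (intro power_mono) auto
  then have "1 + 2 * (norm a)\<^sup>2 \<le> (Re w)\<^sup>2"
    using norm_ge_zero[of a] by (auto simp: power2_sum intro: order_trans[rotated])
  moreover have "(Re w)\<^sup>2 \<le> (norm w)\<^sup>2"
    by (simp add: cmod_power2)
  moreover have "(norm w)\<^sup>2 - (norm a)\<^sup>2 \<le> norm (w\<^sup>2 + a\<^sup>2)"
    using norm_diff_ineq[of "w\<^sup>2" "a\<^sup>2"] by (simp add: norm_power)
  ultimately show ?thesis by (simp add: field_simps)
qed

lemma square_plus_square_eq_0_iff: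
  fixes w a :: complex
  shows "w\<^sup>2 + a\<^sup>2 = 0 \<longleftrightarrow> w = \<i> * a \<or> w = - (\<i> * a)"
proof -
  have "w\<^sup>2 + a\<^sup>2 = (w - \<i> * a) * (w + \<i> * a)"
    by (simp add: algebra_simps power2_eq_square)
  then show ?thesis by (auto simp: add_eq_0_iff2)
qed

lemma of_real_square_plus_square_nonzero:
  assumes "0 < Re a"
  shows "(of_real x)\<^sup>2 + a\<^sup>2 \<noteq> 0"
  using assms unfolding square_plus_square_eq_0_iff by (auto simp: complex_eq_iff)

lemma integrable_inverse_square_plus_square:
  assumes "0 < Re a"
  shows "integrable lborel (\<lambda>x. 1 / ((of_real x)\<^sup>2 + a\<^sup>2))"
proof -
  have nz: "w\<^sup>2 + a\<^sup>2 \<noteq> 0" if "Im w = 0" for w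
    using of_real_square_plus_square_nonzero[OF assms, of "Re w"] that
    by (simp add: complex_is_Real_iff of_real_Re)
  obtain C where C: "\<And>x b. 0 \<le> b \<Longrightarrow> b \<le> 0 \<Longrightarrow>
      norm (1 / ((Complex x b)\<^sup>2 + a\<^sup>2)) \<le> C / (1 + x\<^sup>2)"
  proof (rule strip_bound_from_tails[where f = "\<lambda>w. 1 / (w\<^sup>2 + a\<^sup>2)" and B = 0
        and M = "1 + 2 * norm a" and C = 2])
    show "continuous_on {w. 0 \<le> Im w \<and> Im w \<le> 0} (\<lambda>w. 1 / (w\<^sup>2 + a\<^sup>2))"
      by (intro continuous_intros) (use nz in auto)
    fix w :: complex
    assume "1 + 2 * norm a \<le> \<bar>Re w\<bar>"
    from norm_square_plus_square_ge[OF this] show "norm (1 / (w\<^sup>2 + a\<^sup>2)) \<le> 2 / (1 + (Re w)\<^sup>2)"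
      using zero_le_power2[of "Re w"]
      by (simp add: norm_divide field_simps add_pos_nonneg) (simp add: divide_simps add_pos_nonneg split: if_splits)
  qed (rule that)
  show ?thesis
  proof (rule integrable_dominated_by_inverse_square[of _ C])
    show "(\<lambda>x. 1 / ((of_real x)\<^sup>2 + a\<^sup>2)) \<in> borel_measurable borel"
      by measurable
    show "norm (1 / ((of_real x)\<^sup>2 + a\<^sup>2)) \<le> C / (1 + x\<^sup>2)" for x
      using C[of 0 x] by (simp add: complex_of_real_def)
  qed
qed

text \<open>Partial fractions give the primitive \<open>(Ln (x - \<i> a) - Ln (x + \<i> a)) / (2 \<i> a)\<close>. Since \<open>Re a > 0\<close>, neither
argument meets the branch cut; they pass it on opposite sides, and the two jumps of \<open>\<pi>\<close>
produce the value.\<close>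

lemma integral_inverse_square_plus_square:
  assumes a: "0 < Re a"
  shows "(\<integral>x. 1 / ((of_real x)\<^sup>2 + a\<^sup>2) \<partial>lborel) = of_real pi / a"
proof -
  have a0: "a \<noteq> 0" using a by auto
  let ?G = "\<lambda>x::real. (Ln (of_real x - \<i> * a) - Ln (of_real x + \<i> * a)) / (2 * \<i> * a)"
  have notin: "of_real x - \<i> * a \<notin> \<real>\<^sub>\<le>\<^sub>0" "of_real x + \<i> * a \<notin> \<real>\<^sub>\<le>\<^sub>0" for x
    using a by (auto simp: complex_nonpos_Reals_iff)
  have nz: "of_real x - \<i> * a \<noteq> 0" "of_real x + \<i> * a \<noteq> 0" for x
    using a by (auto simp: complex_eq_iff)
  have deriv: "(?G has_vector_derivative 1 / ((of_real x)\<^sup>2 + a\<^sup>2)) (at x)" for x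
  proof -
    have "(of_real x)\<^sup>2 + a\<^sup>2 = (of_real x - \<i> * a) * (of_real x + \<i> * a)"
      by (simp add: algebra_simps power2_eq_square)
    then have eq: "1 / ((of_real x)\<^sup>2 + a\<^sup>2)
        = (1 / (of_real x - \<i> * a) - 1 / (of_real x + \<i> * a)) / (2 * \<i> * a)"
      using nz[of x] a0 by (simp add: divide_simps)
    have "((\<lambda>z. (Ln (z - \<i> * a) - Ln (z + \<i> * a)) / (2 * \<i> * a)) has_field_derivative
        1 / ((of_real x)\<^sup>2 + a\<^sup>2)) (at (of_real x))"
      unfolding eq using notin[of x] a0 by (auto intro!: derivative_eq_intros simp: divide_simps)
    from has_vector_derivative_real_field[OF this] show ?thesis .
  qed
  have ln_lim: "((\<lambda>R. Ln (of_real R + c) - Ln (of_real R)) \<longlongrightarrow> 0) at_top"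
    if "\<And>x. of_real x + c \<noteq> 0" for c :: complex
  proof -
    have "((\<lambda>R::real. of_real (1 / R)) \<longlongrightarrow> complex_of_real 0) at_top"
      by (intro tendsto_of_real) real_asymp
    then have "((\<lambda>R::real. 1 + c * of_real (1 / R)) \<longlongrightarrow> 1 + c * of_real 0) at_top"
      by (rule tendsto_add[OF tendsto_const tendsto_mult[OF tendsto_const]])
    then have "((\<lambda>R. Ln (1 + c * of_real (1 / R))) \<longlongrightarrow> Ln (1 + c * of_real 0)) at_top"
      by (rule tendsto_Ln) simp
    moreover have "\<forall>\<^sub>F R in at_top. Ln (1 + c * of_real (1 / R)) = Ln (of_real R + c) - Ln (of_real R)"
      using eventually_gt_at_top[of 0]
    proof eventually_elim
      case (elim R)
      then have R: "of_real R + c = of_real R * (1 + c * of_real (1 / R))"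
        by (simp add: field_simps)
      then have "1 + c * of_real (1 / R) \<noteq> 0" using that[of R] by auto
      with elim show ?case
        unfolding R by (subst Ln_times_of_real) (auto simp: Ln_of_real)
    qed
    ultimately show ?thesis using tendsto_cong by fastforce
  qed
  have "((\<lambda>R. ?G R - ?G (- R)) \<longlongrightarrow> (2 * 0 - 2 * 0 + 2 * of_real pi * \<i>) / (2 * \<i> * a)) at_top"
  proof -
    have "?G R - ?G (- R) = (2 * (Ln (of_real R + - (\<i> * a)) - Ln (of_real R))
        - 2 * (Ln (of_real R + \<i> * a) - Ln (of_real R)) + 2 * of_real pi * \<i>) / (2 * \<i> * a)" for R
    proof -
      have "Ln (of_real (- R) - \<i> * a) = Ln (- (of_real R + \<i> * a))" by (simp add: algebra_simps)
      also have "\<dots> = Ln (of_real R + \<i> * a) - \<i> * pi"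
        using nz[of R] a by (subst Ln_minus) auto
      finally have 1: "Ln (of_real (- R) - \<i> * a) = Ln (of_real R + \<i> * a) - \<i> * pi" .
      have "Ln (of_real (- R) + \<i> * a) = Ln (- (of_real R - \<i> * a))" by (simp add: algebra_simps)
      also have "\<dots> = Ln (of_real R - \<i> * a) + \<i> * pi"
        using nz[of R] a by (subst Ln_minus) auto
      finally have 2: "Ln (of_real (- R) + \<i> * a) = Ln (of_real R - \<i> * a) + \<i> * pi" .
      show ?thesis unfolding 1 2 using a0 by (simp add: divide_simps)
    qed
    then show ?thesis
      using nz a0 by (simp only:) (intro tendsto_intros ln_lim; simp)
  qed
  moreover have "((\<lambda>R. ?G R - ?G (- R)) \<longlongrightarrow> (\<integral>x. 1 / ((of_real x)\<^sup>2 + a\<^sup>2) \<partial>lborel)) at_top"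
    by (intro FTC_symmetric_limit deriv integrable_inverse_square_plus_square[OF a] continuous_intros)
       (use of_real_square_plus_square_nonzero[OF a] in auto)
  ultimately have "(\<integral>x. 1 / ((of_real x)\<^sup>2 + a\<^sup>2) \<partial>lborel)
      = (2 * 0 - 2 * 0 + 2 * of_real pi * \<i>) / (2 * \<i> * a)"
    using tendsto_unique trivial_limit_at_top_linorder by blast
  also have "\<dots> = of_real pi / a" using a0 by (simp add: field_simps)
  finally show ?thesis .
qed

text \<open>A residue computation without residues. Replacing \<open>exp (\<i> l x)\<close> by \<open>exp (\<i> l x) - exp (- l a)\<close> cancels the
pole at \<open>\<i> a\<close>, so the line of integration can be pushed up to infinity, where the integral vanishes.
Hence only the integral of \<open>exp (- l a) / (x\<^sup>2 + a\<^sup>2)\<close> remains.\<close>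

lemma fourier_inverse_square_plus_square:
  assumes a: "0 < Re a" and l: "0 < l"
  shows "integrable lborel (\<lambda>x. exp (\<i> * of_real (l * x)) / ((of_real x)\<^sup>2 + a\<^sup>2))"
    and "(\<integral>x. exp (\<i> * of_real (l * x)) / ((of_real x)\<^sup>2 + a\<^sup>2) \<partial>lborel)
          = of_real pi * exp (- of_real l * a) / a"
proof -
  let ?e = "\<lambda>w. exp (\<i> * of_real l * w)"
  let ?c = "exp (- of_real l * a)"
  have c: "?e (\<i> * a) = ?c" by (simp add: algebra_simps)
  have norm_c: "norm ?c \<le> 1" using a l by simp
  have norm_e: "norm (?e w) \<le> 1" if "0 \<le> Im w" for w
    using that l by simp
  note nz = of_real_square_plus_square_nonzero[OF a]
  note int0 = integrable_inverse_square_plus_square[OF a]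
  show int: "integrable lborel (\<lambda>x. exp (\<i> * of_real (l * x)) / ((of_real x)\<^sup>2 + a\<^sup>2))"
    by (rule Bochner_Integration.integrable_bound[OF int0]) (auto simp: norm_divide)
  define q where "q = (\<lambda>w. if w = \<i> * a then deriv ?e (\<i> * a) else (?e w - ?e (\<i> * a)) / (w - \<i> * a))"
  define K where "K = (\<lambda>w. q w / (w + \<i> * a))"
  define S where "S = {w. - Re a < Im w}"
  have "?e holomorphic_on UNIV" by (intro holomorphic_intros)
  from pole_lemma_open[OF this, of "\<i> * a"] have q_holo: "q holomorphic_on T" for T
    by (auto simp: q_def intro: holomorphic_on_subset)
  have K_holo: "K holomorphic_on S"
    unfolding K_def by (intro holomorphic_intros q_holo) (auto simp: S_def complex_eq_iff)
  have K_eq: "K w = (?e w - ?c) / (w\<^sup>2 + a\<^sup>2)" if "w \<noteq> \<i> * a" for w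
  proof -
    have "w\<^sup>2 + a\<^sup>2 = (w - \<i> * a) * (w + \<i> * a)"
      by (simp add: algebra_simps power2_eq_square)
    then show ?thesis using that by (simp add: K_def q_def c del: exp_minus)
  qed
  have K_norm: "norm (K w) \<le> 2 / norm (w\<^sup>2 + a\<^sup>2)" if "w \<noteq> \<i> * a" "0 \<le> Im w" for w
  proof -
    have "norm (?e w - ?c) \<le> 2"
      using norm_triangle_ineq4[of "?e w" ?c] norm_e[OF that(2)] norm_c by linarith
    then show ?thesis unfolding K_eq[OF that(1)] by (simp add: norm_divide divide_right_mono)
  qed
  have shift: "(\<integral>x. K (of_real x) \<partial>lborel) = (\<integral>x. K (Complex x B) \<partial>lborel)"
    "integrable lborel (\<lambda>x. K (of_real x))" if B: "0 \<le> B" for B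
  proof -
    have open_S: "open S" unfolding S_def by (intro open_halfspace_Im_gt)
    have convex_S: "convex S" unfolding S_def by (rule convex_halfspace_Im_gt)
    have sub: "w \<in> S" if "0 \<le> Im w" "Im w \<le> B" for w
      using that a by (simp add: S_def)
    obtain C where C: "\<And>x b. 0 \<le> b \<Longrightarrow> b \<le> B \<Longrightarrow> norm (K (Complex x b)) \<le> C / (1 + x\<^sup>2)"
    proof (rule strip_bound_from_tails[where f = K and B = B and M = "1 + 2 * norm a" and C = 4])
      show "continuous_on {w. 0 \<le> Im w \<and> Im w \<le> B} K"
        using sub by (intro continuous_on_subset[OF holomorphic_on_imp_continuous_on[OF K_holo]]) auto
      fix w assume w: "0 \<le> Im w" "1 + 2 * norm a \<le> \<bar>Re w\<bar>"
      have "w \<noteq> \<i> * a" using w(2) abs_Im_le_cmod[of a] norm_ge_zero[of a] by auto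
      from K_norm[OF this w(1)] have "norm (K w) \<le> 2 / norm (w\<^sup>2 + a\<^sup>2)" .
      also have "\<dots> \<le> 2 / ((1 + (Re w)\<^sup>2) / 2)"
      proof -
        have "0 < (1 + (Re w)\<^sup>2) / 2" by (simp add: add_pos_nonneg)
        with norm_square_plus_square_ge[OF w(2)] show ?thesis
          by (meson divide_left_mono less_le_trans mult_pos_pos zero_le_numeral)
      qed
      finally show "norm (K w) \<le> 4 / (1 + (Re w)\<^sup>2)" by simp
    qed (rule that)
    from integral_horizontal_shift[OF open_S convex_S sub B K_holo C]
    show "(\<integral>x. K (of_real x) \<partial>lborel) = (\<integral>x. K (Complex x B) \<partial>lborel)"
      "integrable lborel (\<lambda>x. K (of_real x))" by auto
  qed
  \<comment> \<open>the integral over the line at height \<open>B\<close> does not depend on \<open>B\<close>, and it tends to zero\<close>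
  have "((\<lambda>B. \<integral>x. K (Complex x B) \<partial>lborel) \<longlongrightarrow> (\<integral>x. 0 \<partial>(lborel :: real measure))) at_top"
  proof (rule integral_dominated_convergence_at_top)
    have far: "norm (K (Complex x B)) \<le> 2 / (1 + x\<^sup>2 + B)" if B: "2 + (norm a)\<^sup>2 + norm a \<le> B" for x B
    proof -
      have "1 + (norm a)\<^sup>2 + B \<le> B * (2 + (norm a)\<^sup>2)"
      proof -
        have "1 \<le> B" using B norm_ge_zero[of a] zero_le_power2[of "norm a"] by linarith
        then have "1 * (1 + (norm a)\<^sup>2) \<le> B * (1 + (norm a)\<^sup>2)"
          by (intro mult_right_mono) auto
        then show ?thesis by (simp add: algebra_simps)
      qed
      also have "\<dots> \<le> B * B"
        using B norm_ge_zero[of a] zero_le_power2[of "norm a"] by (intro mult_left_mono) linarith+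
      finally have B2: "1 + (norm a)\<^sup>2 + B \<le> B * B" .
      have "(norm (Complex x B))\<^sup>2 - (norm a)\<^sup>2 \<le> norm ((Complex x B)\<^sup>2 + a\<^sup>2)"
        using norm_diff_ineq[of "(Complex x B)\<^sup>2" "a\<^sup>2"] by (simp add: norm_power)
      then have ge: "1 + x\<^sup>2 + B \<le> norm ((Complex x B)\<^sup>2 + a\<^sup>2)"
        using B2 unfolding cmod_power2 by (simp add: power2_eq_square)
      have "Complex x B \<noteq> \<i> * a"
      proof
        assume "Complex x B = \<i> * a"
        then have "B = Re a" by (simp add: complex_eq_iff)
        with B complex_Re_le_cmod[of a] zero_le_power2[of "norm a"] show False by linarith
      qed
      from K_norm[OF this] have "norm (K (Complex x B)) \<le> 2 / norm ((Complex x B)\<^sup>2 + a\<^sup>2)"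
        using B norm_ge_zero[of a] zero_le_power2[of "norm a"] by (smt (verit) complex.sel(2))
      also have "\<dots> \<le> 2 / (1 + x\<^sup>2 + B)"
        using ge B norm_ge_zero[of a] zero_le_power2[of "norm a"] zero_le_power2[of x]
        by (intro divide_left_mono mult_pos_pos) linarith+
      finally show ?thesis .
    qed
    show "AE x in lborel. ((\<lambda>B. K (Complex x B)) \<longlongrightarrow> 0) at_top"
    proof (rule AE_I2)
      fix x :: real
      have "((\<lambda>B. 2 / (1 + x\<^sup>2 + B)) \<longlongrightarrow> 0) at_top" by real_asymp
      then show "((\<lambda>B. K (Complex x B)) \<longlongrightarrow> 0) at_top"
        by (rule Lim_null_comparison[rotated])
           (use eventually_ge_at_top[of "2 + (norm a)\<^sup>2 + norm a"] in
             \<open>eventually_elim, use far in auto\<close>)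
    qed
    show "\<forall>\<^sub>F B in at_top. AE x in lborel. norm (K (Complex x B)) \<le> 2 / (1 + x\<^sup>2)"
      using eventually_ge_at_top[of "2 + (norm a)\<^sup>2 + norm a"]
    proof eventually_elim
      case (elim B)
      then have "0 \<le> B" using norm_ge_zero[of a] zero_le_power2[of "norm a"] by linarith
      then have "2 / (1 + x\<^sup>2 + B) \<le> 2 / (1 + x\<^sup>2)" for x :: real
        by (intro divide_left_mono mult_pos_pos) (auto simp: add_pos_nonneg)
      with far[OF elim] show ?case by (intro AE_I2) (blast intro: order_trans)
    qed
    have q_cont: "continuous_on UNIV q"
      using q_holo by (rule holomorphic_on_imp_continuous_on)
    show "(\<lambda>x. K (Complex x B)) \<in> borel_measurable lborel" for B
      using borel_measurable_continuous_onI[OF q_cont, measurable] unfolding K_def Complex_eq by measurable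
  qed (auto intro: integrable_inverse_one_plus_square)
  moreover have "\<forall>\<^sub>F B in at_top. (\<integral>x. K (Complex x B) \<partial>lborel) = (\<integral>x. K (of_real x) \<partial>lborel)"
    using eventually_ge_at_top[of 0] by eventually_elim (simp add: shift)
  ultimately have "((\<lambda>B::real. \<integral>x. K (of_real x) \<partial>lborel) \<longlongrightarrow> 0) at_top"
    using tendsto_cong by fastforce
  then have zero: "(\<integral>x. K (of_real x) \<partial>lborel) = 0"
    using tendsto_unique[OF trivial_limit_at_top_linorder tendsto_const] by blast
  have "(\<integral>x. exp (\<i> * of_real (l * x)) / ((of_real x)\<^sup>2 + a\<^sup>2) \<partial>lborel)
      = (\<integral>x. K (of_real x) + ?c * (1 / ((of_real x)\<^sup>2 + a\<^sup>2)) \<partial>lborel)"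
  proof (rule Bochner_Integration.integral_cong)
    fix x :: real
    have "of_real x \<noteq> \<i> * a" using a by (auto simp: complex_eq_iff)
    from K_eq[OF this] show "exp (\<i> * of_real (l * x)) / ((of_real x)\<^sup>2 + a\<^sup>2)
        = K (of_real x) + ?c * (1 / ((of_real x)\<^sup>2 + a\<^sup>2))"
      by (simp add: diff_divide_distrib mult.assoc)
  qed simp
  also have "\<dots> = (\<integral>x. K (of_real x) \<partial>lborel) + ?c * (\<integral>x. 1 / ((of_real x)\<^sup>2 + a\<^sup>2) \<partial>lborel)"
    using shift(2)[of 0] int0
    by (simp only: Bochner_Integration.integral_add integral_mult_right_zero integrable_mult_right order_refl)
  also have "\<dots> = of_real pi * ?c / a"
    unfolding zero integral_inverse_square_plus_square[OF a] by simp
  finally show "(\<integral>x. exp (\<i> * of_real (l * x)) / ((of_real x)\<^sup>2 + a\<^sup>2) \<partial>lborel)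
      = of_real pi * ?c / a" .
qed

section \<open>The Gaussian integral with complex parameter\<close>

text \<open>With \<open>u\<^sup>2 = s\<close> the integral is, up to the factor \<open>u\<close>, the increment of a primitive of \<open>exp (- w\<^sup>2)\<close> along the
line of direction \<open>u\<close>. Comparing the points \<open>u R\<close> and \<open>Re u R\<close>, which lie on one vertical line,
reduces it to the real Gaussian: on the segment between them \<open>Re (w\<^sup>2)\<close> is at least \<open>Re s R\<^sup>2\<close>.\<close>

lemma integral_gaussian_complex:
  assumes s: "0 < Re s"
  shows "(\<integral>t. exp (- s * (of_real t)\<^sup>2) \<partial>lborel) = of_real (sqrt pi) / csqrt s"
proof -
  define u where "u = csqrt s"
  define p where "p = Re u"
  define q where "q = Im u"
  have u2: "u\<^sup>2 = s" by (simp add: u_def)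
  have pq: "q\<^sup>2 < p\<^sup>2"
    using s unfolding u2[symmetric] p_def q_def by (simp add: power2_eq_square)
  have "s \<noteq> 0" using s by auto
  then have "u \<noteq> 0" by (simp add: u_def)
  have "0 \<le> p" using csqrt_principal[of s] by (auto simp: p_def u_def)
  then have p: "0 < p" using pq by (cases "p = 0") auto
  have exp_le: "exp (- c * x\<^sup>2) \<le> max 1 (1 / c) / (1 + x\<^sup>2)" if c: "0 < c" for c x :: real
  proof -
    have "1 + x\<^sup>2 \<le> max 1 (1 / c) * (1 + c * x\<^sup>2)"
    proof -
      have "1 * x\<^sup>2 \<le> (max 1 (1 / c) * c) * x\<^sup>2"
        using c by (intro mult_right_mono) (auto simp: max_def field_simps)
      then show ?thesis by (simp add: algebra_simps)
    qed
    also have "\<dots> \<le> max 1 (1 / c) * exp (c * x\<^sup>2)"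
      by (intro mult_left_mono exp_ge_add_one_self) auto
    finally show ?thesis
      by (simp add: exp_minus divide_simps add_pos_nonneg) 
  qed
  have int: "integrable lborel (\<lambda>t. exp (- z * (of_real t)\<^sup>2))" if z: "0 < Re z" for z
  proof (rule integrable_dominated_by_inverse_square)
    show "(\<lambda>t. exp (- z * (of_real t)\<^sup>2)) \<in> borel_measurable borel"
      by (intro borel_measurable_continuous_onI continuous_intros)
    show "norm (exp (- z * (of_real t)\<^sup>2)) \<le> max 1 (1 / Re z) / (1 + t\<^sup>2)" for t
      using exp_le[OF z, of t] by (simp flip: of_real_power)
  qed
  have "(\<lambda>w. exp (- w\<^sup>2)) holomorphic_on UNIV" by (intro holomorphic_intros)
  then have "\<exists>E. \<forall>w::complex. (E has_field_derivative exp (- w\<^sup>2)) (at w)"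
    by (rule holomorphic_convex_primitive'[OF convex_UNIV open_UNIV]) auto
  then obtain E where E: "\<And>w::complex. (E has_field_derivative exp (- w\<^sup>2)) (at w)" by blast
  have ray: "((\<lambda>t. E (v * of_real t)) has_vector_derivative v * exp (- v\<^sup>2 * (of_real t)\<^sup>2)) (at t)" for v t
  proof -
    have "((\<lambda>w. E (v * w)) has_field_derivative exp (- (v * of_real t)\<^sup>2) * v) (at (of_real t))"
      by (rule DERIV_chain2[OF E]) (auto intro!: derivative_eq_intros)
    from has_vector_derivative_real_field[OF this] show ?thesis
      by (simp add: power_mult_distrib mult.commute)
  qed
  have ray_limit: "((\<lambda>R. E (v * of_real R) - E (v * of_real (- R))) \<longlongrightarrow>
      v * (\<integral>t. exp (- v\<^sup>2 * (of_real t)\<^sup>2) \<partial>lborel)) at_top" if "0 < Re (v\<^sup>2)" for v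
  proof -
    have "((\<lambda>R. E (v * of_real R) - E (v * of_real (- R))) \<longlongrightarrow>
        (\<integral>t. v * exp (- v\<^sup>2 * (of_real t)\<^sup>2) \<partial>lborel)) at_top"
      using int[OF that] by (intro FTC_symmetric_limit ray continuous_intros integrable_mult_right)
    then show ?thesis using int[OF that] by simp
  qed
  have real_gauss: "(\<integral>t. exp (- (complex_of_real p)\<^sup>2 * (of_real t)\<^sup>2) \<partial>lborel) = of_real (sqrt pi / p)"
  proof -
    have "has_bochner_integral lborel (\<lambda>x::real. exp (- x\<^sup>2)) (2 *\<^sub>R (sqrt pi / 2))"
      by (rule has_bochner_integral_even_function[OF gaussian_moment_0]) simp
    then have "sqrt pi = (\<integral>x. exp (- x\<^sup>2) \<partial>lborel)"
      by (simp add: has_bochner_integral_iff)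
    also have "\<dots> = p * (\<integral>t. exp (- (p * t)\<^sup>2) \<partial>lborel)"
      using p lborel_integral_real_affine[of p "\<lambda>x::real. exp (- x\<^sup>2)" 0] by simp
    finally have "(\<integral>t. exp (- (p * t)\<^sup>2) \<partial>lborel) = sqrt pi / p"
      using p by (simp add: field_simps)
    moreover have "exp (- (complex_of_real p)\<^sup>2 * (of_real t)\<^sup>2) = of_real (exp (- (p * t)\<^sup>2))" for t
      by (simp add: power_mult_distrib flip: exp_of_real)
    ultimately show ?thesis by (simp only: integral_complex_of_real)
  qed
  have side: "norm (E (u * of_real R) - E (of_real p * of_real R))
      \<le> exp (- (p\<^sup>2 - q\<^sup>2) * R\<^sup>2) * (\<bar>q\<bar> * \<bar>R\<bar>)" for R
  proof -
    let ?seg = "closed_segment (u * of_real R) (of_real p * of_real R)"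
    have deriv_bound: "norm (exp (- w\<^sup>2)) \<le> exp (- (p\<^sup>2 - q\<^sup>2) * R\<^sup>2)" if w_seg: "w \<in> ?seg" for w
    proof -
      obtain v where v: "0 \<le> v" "v \<le> 1"
          "w = (1 - v) *\<^sub>R (u * of_real R) + v *\<^sub>R (of_real p * of_real R)"
        using iffD1[OF in_segment(1) w_seg] by blast
      have w: "Re w = p * R" "Im w = (1 - v) * (q * R)"
        unfolding v(3) p_def q_def by (simp_all add: algebra_simps)
      have "(Im w)\<^sup>2 = (1 - v)\<^sup>2 * (q * R)\<^sup>2"
        by (simp add: w power_mult_distrib)
      also have "\<dots> \<le> 1 * (q * R)\<^sup>2"
        using v by (intro mult_right_mono power_le_one) auto
      finally have "(p\<^sup>2 - q\<^sup>2) * R\<^sup>2 \<le> (Re w)\<^sup>2 - (Im w)\<^sup>2"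
        by (simp add: w(1) algebra_simps)
      moreover have "Re (- w\<^sup>2) = (Im w)\<^sup>2 - (Re w)\<^sup>2" by (simp add: power2_eq_square)
      ultimately have "Re (- w\<^sup>2) \<le> - ((p\<^sup>2 - q\<^sup>2) * R\<^sup>2)" by linarith
      then show ?thesis unfolding norm_exp_eq_Re minus_mult_left by (rule exp_mono)
    qed
    have "norm (E (u * of_real R) - E (of_real p * of_real R))
      \<le> exp (- (p\<^sup>2 - q\<^sup>2) * R\<^sup>2) * norm (u * of_real R - of_real p * of_real R)"
      by (rule field_differentiable_bound[of ?seg E "\<lambda>w. exp (- w\<^sup>2)"])
         (use E deriv_bound in \<open>auto intro: has_field_derivative_at_within\<close>)
    also have "u * of_real R - of_real p * of_real R = \<i> * of_real q * of_real R"
      by (auto simp: complex_eq_iff p_def q_def)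
    finally show ?thesis by (simp add: norm_mult)
  qed
  have side_lim: "((\<lambda>R. exp (- (p\<^sup>2 - q\<^sup>2) * R\<^sup>2) * (\<bar>q\<bar> * \<bar>R\<bar>)) \<longlongrightarrow> 0) at_top"
  proof -
    have "((\<lambda>R. exp (- d * R\<^sup>2) * (\<bar>q\<bar> * \<bar>R\<bar>)) \<longlongrightarrow> 0) at_top" if "0 < d" for d :: real
      using that by real_asymp
    from this[of "p\<^sup>2 - q\<^sup>2"] pq show ?thesis by simp
  qed
  let ?side = "\<lambda>R. E (u * of_real R) - E (of_real p * of_real R)"
  have "(?side \<longlongrightarrow> 0) at_top"
    by (rule Lim_null_comparison[OF _ side_lim]) (use side in simp)
  moreover have "((\<lambda>R. ?side (- R)) \<longlongrightarrow> 0) at_top"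
    by (rule Lim_null_comparison[OF _ side_lim]) (use side[of "- R" for R] in simp)
  moreover have "((\<lambda>R. E (of_real p * of_real R) - E (of_real p * of_real (- R))) \<longlongrightarrow>
      of_real p * of_real (sqrt pi / p)) at_top"
    using ray_limit[of "of_real p"] p unfolding real_gauss by (simp flip: of_real_power)
  ultimately have "((\<lambda>R. ?side R - ?side (- R) + (E (of_real p * of_real R) - E (of_real p * of_real (- R))))
      \<longlongrightarrow> 0 - 0 + of_real p * of_real (sqrt pi / p)) at_top"
    by (intro tendsto_add tendsto_diff)
  then have "((\<lambda>R. E (u * of_real R) - E (u * of_real (- R))) \<longlongrightarrow> of_real (sqrt pi)) at_top"
    using p by (simp add: algebra_simps)
  moreover have "((\<lambda>R. E (u * of_real R) - E (u * of_real (- R))) \<longlongrightarrow>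
      u * (\<integral>t. exp (- s * (of_real t)\<^sup>2) \<partial>lborel)) at_top"
    using ray_limit[of u] s unfolding u2 by simp
  ultimately have "u * (\<integral>t. exp (- s * (of_real t)\<^sup>2) \<partial>lborel) = of_real (sqrt pi)"
    using tendsto_unique trivial_limit_at_top_linorder by blast
  with \<open>u \<noteq> 0\<close> show ?thesis by (simp add: u_def field_simps)
qed

section \<open>Removing the lowest poles of the Fermi function\<close>

lemma holomorphic_factor_zero:
  assumes "f holomorphic_on S" "open S" "f p = 0"
  shows "\<exists>k. k holomorphic_on S \<and> (\<forall>z. f z = (z - p) * k z)"
proof (intro exI conjI allI)
  show "(\<lambda>z. if z = p then deriv f p else (f z - f p) / (z - p)) holomorphic_on S"
    using assms(1,2) by (rule pole_lemma_open)
  show "f z = (z - p) * (if z = p then deriv f p else (f z - f p) / (z - p))" for z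
    using assms(3) by simp
qed

lemma holomorphic_factor_two_zeros:
  assumes "f holomorphic_on S" "open S" "f p = 0" "f q = 0" "p \<noteq> q"
  shows "\<exists>k. k holomorphic_on S \<and> (\<forall>z. f z = (z - p) * (z - q) * k z)"
proof -
  obtain h where h: "h holomorphic_on S" "\<And>z. f z = (z - p) * h z"
    using holomorphic_factor_zero[OF assms(1-3)] by blast
  have "h q = 0" using h(2)[of q] assms(4,5) by simp
  then obtain k where "k holomorphic_on S" "\<And>z. h z = (z - q) * k z"
    using holomorphic_factor_zero[OF h(1) assms(2)] by blast
  with h(2) show ?thesis by (intro exI[of _ k]) (auto simp: mult.assoc)
qed

text \<open>The image of the strip \<open>0 \<le> Im x \<le> 3/2\<close> under \<open>x \<mapsto> x\<^sup>2 + y\<^sup>2\<close>, over all real \<open>y\<close>, lies in this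
region.\<close>

definition parabola_region :: "complex set" where
  "parabola_region = {z. (Im z)\<^sup>2 \<le> 9 * (Re z + 9 / 4)}"

text \<open>An open neighbourhood of the parabola region that contains \<open>\<plusminus> \<i> \<pi>\<close> but no other pole of the Fermi function
\<open>1 / (1 + exp z)\<close>, and not the point \<open>- 4\<close>.\<close>

definition fermi_domain :: "complex set" where
  "fermi_domain = {z. - 4 < Re z \<and> (\<bar>Im z\<bar> < 3 * pi \<or> 0 < Re z)}"

lemma open_fermi_domain: "open fermi_domain"
  unfolding fermi_domain_def
  by (intro open_Collect_conj open_Collect_disj open_Collect_less continuous_intros)

lemma one_plus_exp_eq_0_fermi_domain:
  assumes "z \<in> fermi_domain" "1 + exp z = 0"
  shows "z = \<i> * of_real pi \<or> z = - (\<i> * of_real pi)"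
proof -
  have "exp z = exp (\<i> * of_real pi)"
    using assms(2) by (simp add: exp_pi_i' add_eq_0_iff)
  then obtain n :: int where n: "z = \<i> * of_real pi + (of_int (2 * n) * pi) * \<i>"
    unfolding exp_eq by blast
  then have z: "Re z = 0" "Im z = (2 * of_int n + 1) * pi"
    by (simp_all add: algebra_simps)
  then have "\<bar>2 * of_int n + 1\<bar> * pi < 3 * pi"
    using assms(1) by (simp add: fermi_domain_def abs_mult)
  then have "\<bar>2 * real_of_int n + 1\<bar> < 3" by simp
  then have "\<bar>2 * n + 1\<bar> < 3" by linarith
  then have "n = 0 \<or> n = - 1" by linarith
  then show ?thesis unfolding n by (auto simp: algebra_simps)
qed

lemma parabola_region_subset: "parabola_region \<subseteq> fermi_domain"
proof
  fix z assume "z \<in> parabola_region"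
  then have z: "(Im z)\<^sup>2 \<le> 9 * (Re z + 9 / 4)" by (simp add: parabola_region_def)
  then have "0 \<le> 9 * (Re z + 9 / 4)" using zero_le_power2[of "Im z"] by linarith
  moreover have "0 < Re z" if "3 * pi \<le> \<bar>Im z\<bar>"
  proof -
    have "9 \<le> \<bar>Im z\<bar>" using that pi_gt3 by linarith
    then have "9\<^sup>2 \<le> \<bar>Im z\<bar>\<^sup>2" by (intro power_mono) auto
    with z show ?thesis by simp
  qed
  ultimately show "z \<in> fermi_domain" unfolding fermi_domain_def by force
qed

text \<open>Subtracting the two principal parts leaves a function that decays only like \<open>1 / z\<close>, and with
\<open>z = x\<^sup>2 + y\<^sup>2\<close> this is not integrable over the plane. The auxiliary pole at \<open>- 4\<close> improves the decay to
\<open>1 / z\<^sup>2\<close>. It is harmless because it contributes at the exponential rate \<open>2\<close>, which exceeds \<open>sqrt (\<pi> / 2)\<close>;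
the poles \<open>\<plusminus> 3 \<i> \<pi>\<close> and beyond stay outside the domain.

The remainder is obtained by dividing twice by \<open>(z - \<i> \<pi>) (z + \<i> \<pi>)\<close>: once \<open>1 + exp z\<close>, with quotient \<open>k\<close>, and
once the numerator \<open>1 / k + (8 z - 2 \<pi>\<^sup>2) / (z + 4)\<close>, whose second term comes from collecting the three
simple fractions.\<close>

lemma fermi_function_remainder:
  obtains H C where "H holomorphic_on fermi_domain"
    and "\<And>z. z \<in> fermi_domain \<Longrightarrow> z \<noteq> \<i> * of_real pi \<Longrightarrow> z \<noteq> - (\<i> * of_real pi) \<Longrightarrow>
      1 / (1 + exp z) = H z - (1 / (z - \<i> * of_real pi) + 1 / (z + \<i> * of_real pi)) + 2 / (z + 4)"
    and "\<And>z. z \<in> parabola_region \<Longrightarrow> norm (H z) \<le> C / (norm (z + 4))\<^sup>2"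
proof -
  let ?p = "\<i> * complex_of_real pi"
  have p_neq: "?p \<noteq> - ?p" by (simp add: complex_eq_iff)
  have p_dom: "?p \<in> fermi_domain" "- ?p \<in> fermi_domain"
    using pi_gt_zero by (auto simp: fermi_domain_def)
  have exp_p: "exp ?p = - 1" "exp (- ?p) = - 1"
    by (simp_all add: exp_pi_i' exp_minus)
  have holo1: "(\<lambda>z::complex. 1 + exp z) holomorphic_on UNIV" by (intro holomorphic_intros)
  obtain k where k_holo: "k holomorphic_on UNIV"
    and k: "\<And>z. 1 + exp z = (z - ?p) * (z - - ?p) * k z"
    using holomorphic_factor_two_zeros[OF holo1 open_UNIV _ _ p_neq] exp_p by auto
  have k_at: "exp c = (c + c) * k c" if "c = ?p \<or> c = - ?p" for c
  proof -
    obtain k' where k': "(k has_field_derivative k') (at c)"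
      using k_holo by (metis UNIV_I field_differentiable_def holomorphic_on_imp_differentiable_at open_UNIV)
    have "((\<lambda>z. (z - ?p) * (z - - ?p) * k z) has_field_derivative
        ((c - - ?p) + (c - ?p)) * k c + (c - ?p) * (c - - ?p) * k') (at c)"
      by (rule derivative_eq_intros k' refl)+ (simp add: algebra_simps)
    moreover have "((c - - ?p) + (c - ?p)) * k c + (c - ?p) * (c - - ?p) * k' = (c + c) * k c"
      using that by auto
    ultimately have "((\<lambda>z. (z - ?p) * (z - - ?p) * k z) has_field_derivative (c + c) * k c) (at c)"
      by (simp only:)
    moreover have "((\<lambda>z. (z - ?p) * (z - - ?p) * k z) has_field_derivative exp c) (at c)"
      unfolding k[symmetric] by (auto intro!: derivative_eq_intros)
    ultimately show ?thesis by (rule DERIV_unique[THEN sym])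
  qed
  have k_nz: "k z \<noteq> 0" if "z \<in> fermi_domain" for z
  proof
    assume "k z = 0"
    then have "1 + exp z = 0" using k[of z] by simp
    from one_plus_exp_eq_0_fermi_domain[OF that this] have "exp z = (z + z) * k z"
      by (rule k_at)
    with \<open>k z = 0\<close> show False by simp
  qed
  have four_nz: "z + 4 \<noteq> 0" if "z \<in> fermi_domain" for z
    using that by (auto simp: fermi_domain_def complex_eq_iff)
  let ?N = "\<lambda>z. 1 / k z + (8 * z - 2 * (of_real pi)\<^sup>2) / (z + 4)"
  have N_holo: "?N holomorphic_on fermi_domain"
    using k_nz four_nz by (intro holomorphic_intros holomorphic_on_subset[OF k_holo]) auto
  have N_zero: "?N c = 0" if c: "c = ?p \<or> c = - ?p" for c
  proof -
    have dom: "c \<in> fermi_domain" using c p_dom by auto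
    have "(c + c) * k c = - 1" using k_at[OF c] exp_p c by auto
    then have "- (c + c) * k c = 1" by simp
    then have "1 / k c = - (c + c)" using k_nz[OF dom] by (simp add: field_simps)
    moreover have "8 * c - 2 * (of_real pi)\<^sup>2 = (c + c) * (c + 4)"
    proof -
      have "c\<^sup>2 = - (of_real pi)\<^sup>2" using c by (auto simp: power_mult_distrib)
      moreover have "(c + c) * (c + 4) = 8 * c + 2 * c\<^sup>2" by (simp add: algebra_simps power2_eq_square)
      ultimately show ?thesis by simp
    qed
    ultimately show ?thesis using four_nz[OF dom] by simp
  qed
  obtain H where H_holo: "H holomorphic_on fermi_domain"
    and H: "\<And>z. ?N z = (z - ?p) * (z - - ?p) * H z"
    using holomorphic_factor_two_zeros[OF N_holo open_fermi_domain N_zero N_zero p_neq] by blast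
  have H_eq: "1 / (1 + exp z) = H z - (8 * z - 2 * (of_real pi)\<^sup>2) / ((z + 4) * ((z - ?p) * (z + ?p)))"
    if "z \<in> fermi_domain" "z \<noteq> ?p" "z \<noteq> - ?p" for z
  proof -
    have nz: "z - ?p \<noteq> 0" "z + ?p \<noteq> 0" using that(2,3) by (auto simp: add_eq_0_iff2)
    have "H z = ?N z / ((z - ?p) * (z + ?p))" using nz H[of z] by simp
    also have "\<dots> = 1 / (1 + exp z) + (8 * z - 2 * (of_real pi)\<^sup>2) / ((z + 4) * ((z - ?p) * (z + ?p)))"
      by (simp add: k add_divide_distrib mult.commute)
    finally show ?thesis by simp
  qed
  have partial: "(8 * z - 2 * (of_real pi)\<^sup>2) / ((z + 4) * ((z - ?p) * (z + ?p)))
      = 1 / (z - ?p) + 1 / (z + ?p) - 2 / (z + 4)"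
    if "z \<in> fermi_domain" "z \<noteq> ?p" "z \<noteq> - ?p" for z
  proof -
    have nz: "z - ?p \<noteq> 0" "z + ?p \<noteq> 0" using that(2,3) by (auto simp: add_eq_0_iff2)
    have "1 / (z - ?p) + 1 / (z + ?p) - 2 / (z + 4)
        = ((z + ?p) * (z + 4) + (z - ?p) * (z + 4) - 2 * ((z - ?p) * (z + ?p)))
          / ((z + 4) * ((z - ?p) * (z + ?p)))"
      using nz four_nz[OF that(1)] by (simp add: divide_simps) (simp add: algebra_simps)
    also have "(z + ?p) * (z + 4) + (z - ?p) * (z + 4) - 2 * ((z - ?p) * (z + ?p))
        = 8 * z - 2 * (of_real pi)\<^sup>2"
      by (simp add: algebra_simps power2_eq_square)
    finally show ?thesis ..
  qed
  have far: "norm (H z) * (norm (z + 4))\<^sup>2 \<le> 1000" if z: "z \<in> parabola_region" "1 \<le> Re z" for z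
  proof -
    define r where "r = Re z"
    have r: "1 \<le> r" using z by (simp add: r_def)
    have r2: "r \<le> r\<^sup>2" using r by (simp add: power2_eq_square)
    have "(Im z)\<^sup>2 \<le> 9 * r + 81 / 4" using z(1) by (simp add: parabola_region_def r_def)
    then have "(norm z)\<^sup>2 \<le> (6 * r)\<^sup>2"
      using r r2 unfolding cmod_power2 r_def[symmetric] power_mult_distrib by simp
    then have z6: "norm z \<le> 6 * r" by (rule power2_le_imp_le) (use r in simp)
    have z4: "norm (z + 4) \<le> 10 * r"
      using norm_triangle_ineq[of z 4] z6 r by simp
    have pole_ge: "r \<le> norm (z - ?p)" "r \<le> norm (z + ?p)"
      using complex_Re_le_cmod[of "z - ?p"] complex_Re_le_cmod[of "z + ?p"] by (auto simp: r_def)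
    have nz: "z \<noteq> ?p" "z \<noteq> - ?p" using r by (auto simp: r_def)
    have dom: "z \<in> fermi_domain" using z(1) parabola_region_subset by blast
    have 1: "norm (1 / (1 + exp z)) * (norm (z + 4))\<^sup>2 \<le> 200"
    proof -
      have "r\<^sup>2 / 2 \<le> exp r - 1"
        using exp_lower_Taylor_quadratic[of r] r by simp
      also have "\<dots> \<le> norm (1 + exp z)"
        using norm_diff_ineq[of "exp z" 1] by (simp add: r_def add.commute)
      finally have e: "r\<^sup>2 / 2 \<le> norm (1 + exp z)" .
      have "(norm (z + 4))\<^sup>2 \<le> (10 * r)\<^sup>2" using z4 by (intro power_mono) auto
      also have "\<dots> = 200 * (r\<^sup>2 / 2)" by (simp add: power_mult_distrib)
      also have "\<dots> \<le> 200 * norm (1 + exp z)" using e by (intro mult_left_mono) auto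
      finally have "(norm (z + 4))\<^sup>2 \<le> 200 * norm (1 + exp z)" .
      moreover have "0 < r\<^sup>2 / 2" using r by simp
      ultimately show ?thesis using e by (simp add: norm_divide divide_simps)
    qed
    have 2: "norm ((8 * z - 2 * (of_real pi)\<^sup>2) / ((z + 4) * ((z - ?p) * (z + ?p)))) * (norm (z + 4))\<^sup>2 \<le> 800"
    proof -
      have "norm (2 * (complex_of_real pi)\<^sup>2) \<le> 2 * 4\<^sup>2"
        using power_mono[of pi 4 2] pi_less_4 pi_gt_zero by (simp add: norm_mult norm_power)
      then have num: "norm (8 * z - 2 * (of_real pi)\<^sup>2) \<le> 80 * r"
        using norm_triangle_ineq4[of "8 * z" "2 * (complex_of_real pi)\<^sup>2"] z6 r by (simp add: norm_mult)
      have den: "r * r \<le> norm (z - ?p) * norm (z + ?p)"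
        using pole_ge r by (intro mult_mono) auto
      have "norm (8 * z - 2 * (of_real pi)\<^sup>2) * norm (z + 4) \<le> (80 * r) * (10 * r)"
        using num z4 r by (intro mult_mono) auto
      also have "\<dots> \<le> 800 * (norm (z - ?p) * norm (z + ?p))" using den by simp
      finally have *: "norm (8 * z - 2 * (of_real pi)\<^sup>2) * norm (z + 4)
          \<le> 800 * (norm (z - ?p) * norm (z + ?p))" .
      have pos: "0 < norm (z - ?p) * norm (z + ?p)" "0 < norm (z + 4)"
        using nz four_nz[OF dom] by (auto simp: add_eq_0_iff2)
      have "norm ((8 * z - 2 * (of_real pi)\<^sup>2) / ((z + 4) * ((z - ?p) * (z + ?p)))) * (norm (z + 4))\<^sup>2
          = norm (8 * z - 2 * (of_real pi)\<^sup>2) * norm (z + 4) / (norm (z - ?p) * norm (z + ?p))"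
        using pos(2) unfolding norm_divide norm_mult power2_eq_square by (simp add: divide_simps)
      also have "\<dots> \<le> 800" using * pos(1) by (simp add: pos_divide_le_eq)
      finally show ?thesis .
    qed
    have "H z = 1 / (1 + exp z) + (8 * z - 2 * (of_real pi)\<^sup>2) / ((z + 4) * ((z - ?p) * (z + ?p)))"
      using H_eq[OF dom nz] by simp
    then have "norm (H z) \<le> norm (1 / (1 + exp z))
        + norm ((8 * z - 2 * (of_real pi)\<^sup>2) / ((z + 4) * ((z - ?p) * (z + ?p))))"
      by (metis norm_triangle_ineq)
    then have "norm (H z) * (norm (z + 4))\<^sup>2 \<le> (norm (1 / (1 + exp z))
        + norm ((8 * z - 2 * (of_real pi)\<^sup>2) / ((z + 4) * ((z - ?p) * (z + ?p))))) * (norm (z + 4))\<^sup>2"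
      by (rule mult_right_mono) simp
    then show ?thesis using 1 2 by (simp only: distrib_right)
  qed
  \<comment> \<open>the part of the parabola region around the removed poles is compact, so continuity bounds \<open>H\<close> there\<close>
  let ?near = "parabola_region \<inter> {z. Re z \<le> 1}"
  have "compact ?near"
  proof -
    have "closed ?near"
      unfolding parabola_region_def
      by (intro closed_Int closed_Collect_le continuous_intros)
    moreover have "?near \<subseteq> cbox (Complex (- 3) (- 6)) (Complex 1 6)"
    proof
      fix z assume "z \<in> ?near"
      then have z: "(Im z)\<^sup>2 \<le> 9 * (Re z + 9 / 4)" "Re z \<le> 1" by (auto simp: parabola_region_def)
      then have "\<bar>Im z\<bar>\<^sup>2 \<le> 6\<^sup>2" by simp
      then have "\<bar>Im z\<bar> \<le> 6" by (rule power2_le_imp_le) simp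
      moreover have "0 \<le> 9 * (Re z + 9 / 4)" using z(1) zero_le_power2[of "Im z"] by linarith
      then have "- 3 \<le> Re z" by simp
      ultimately show "z \<in> cbox (Complex (- 3) (- 6)) (Complex 1 6)"
        using z(2) by (auto simp: in_cbox_complex_iff)
    qed
    ultimately show ?thesis
      by (meson bounded_cbox bounded_subset compact_eq_bounded_closed)
  qed
  moreover have "continuous_on ?near (\<lambda>z. H z * (z + 4)\<^sup>2)"
    using parabola_region_subset
    by (intro continuous_intros continuous_on_subset[OF holomorphic_on_imp_continuous_on[OF H_holo]]) auto
  ultimately have "compact ((\<lambda>z. H z * (z + 4)\<^sup>2) ` ?near)"
    by (rule compact_continuous_image[rotated])
  then obtain D where "\<forall>w \<in> (\<lambda>z. H z * (z + 4)\<^sup>2) ` ?near. norm w \<le> D"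
    using compact_imp_bounded bounded_iff by blast
  then have D: "norm (H z) * (norm (z + 4))\<^sup>2 \<le> D" if "z \<in> ?near" for z
    using that by (auto simp: norm_mult norm_power)
  have bound: "norm (H z) \<le> max 1000 D / (norm (z + 4))\<^sup>2" if z: "z \<in> parabola_region" for z
  proof -
    have "norm (H z) * (norm (z + 4))\<^sup>2 \<le> max 1000 D"
      using far[OF z] D[of z] z by (cases "1 \<le> Re z") auto
    moreover have "0 < norm (z + 4)" using z parabola_region_subset four_nz by auto
    ultimately show ?thesis by (simp add: pos_le_divide_eq)
  qed
  show thesis
  proof (rule that[OF H_holo _ bound])
    fix z assume z: "z \<in> fermi_domain" "z \<noteq> ?p" "z \<noteq> - ?p"
    show "1 / (1 + exp z) = H z - (1 / (z - ?p) + 1 / (z + ?p)) + 2 / (z + 4)"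
      unfolding H_eq[OF z] partial[OF z] by simp
  qed
qed

section \<open>Laplace's method for the hypotenuse\<close>

text \<open>For fixed \<open>y\<close> the function \<open>x \<mapsto> 1 / (x\<^sup>2 + y\<^sup>2 + b\<^sup>2)\<close> has its pole in the upper half plane at \<open>\<i>\<close> times this
number.\<close>

definition hypotenuse :: "complex \<Rightarrow> real \<Rightarrow> complex" where
  "hypotenuse b y = csqrt ((of_real y)\<^sup>2 + b\<^sup>2)"

lemma hypotenuse_square: "(hypotenuse b y)\<^sup>2 = (of_real y)\<^sup>2 + b\<^sup>2"
  by (simp add: hypotenuse_def)

text \<open>The condition says \<open>|arg b| \<le> \<pi> / 4\<close>, that is \<open>Re (b\<^sup>2) \<ge> 0\<close>. The hypotenuse with real \<open>y\<close> then stays in the same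
sector and off the branch cut. The boundary case \<open>|arg b| = \<pi> / 4\<close> is the one that matters here.\<close>

locale sector =
  fixes b :: complex
  assumes Re_pos: "0 < Re b" and Im_le_Re: "\<bar>Im b\<bar> \<le> Re b"
begin

lemma Re_square_nonneg: "0 \<le> Re (b\<^sup>2)"
proof -
  have "\<bar>Im b\<bar>\<^sup>2 \<le> (Re b)\<^sup>2" using Im_le_Re by (intro power_mono) auto
  then show ?thesis by (simp add: power2_eq_square)
qed

lemma hypotenuse_sector: "\<bar>Im (hypotenuse b y)\<bar> \<le> Re (hypotenuse b y)"
proof -
  have "0 \<le> Re ((hypotenuse b y)\<^sup>2)"
    using Re_square_nonneg unfolding hypotenuse_square by (simp flip: of_real_power)
  then have "(Im (hypotenuse b y))\<^sup>2 \<le> (Re (hypotenuse b y))\<^sup>2"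
    by (simp add: power2_eq_square)
  moreover have "0 \<le> Re (hypotenuse b y)"
    using csqrt_principal[of "(of_real y)\<^sup>2 + b\<^sup>2"] by (auto simp: hypotenuse_def)
  ultimately show ?thesis by (simp add: power2_le_iff_abs_le)
qed

lemma norm_hypotenuse_ge: "norm b \<le> norm (hypotenuse b y)"
proof -
  have "(norm (b\<^sup>2))\<^sup>2 \<le> (norm ((of_real y)\<^sup>2 + b\<^sup>2))\<^sup>2"
  proof -
    have "(Re (b\<^sup>2))\<^sup>2 \<le> (y\<^sup>2 + Re (b\<^sup>2))\<^sup>2"
      using Re_square_nonneg by (intro power_mono) auto
    then show ?thesis unfolding cmod_power2 by (simp flip: of_real_power)
  qed
  then have "norm (b\<^sup>2) \<le> norm ((hypotenuse b y)\<^sup>2)"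
    unfolding hypotenuse_square by (rule power2_le_imp_le) simp
  then have "(norm b)\<^sup>2 \<le> (norm (hypotenuse b y))\<^sup>2" by (simp add: norm_power)
  then show ?thesis by (rule power2_le_imp_le) simp
qed

lemma norm_hypotenuse_le: "norm (hypotenuse b y) \<le> \<bar>y\<bar> + norm b"
proof -
  have "(norm (hypotenuse b y))\<^sup>2 = norm ((of_real y)\<^sup>2 + b\<^sup>2)"
    by (simp add: hypotenuse_square flip: norm_power)
  also have "\<dots> \<le> y\<^sup>2 + (norm b)\<^sup>2"
    using norm_triangle_ineq[of "(of_real y)\<^sup>2" "b\<^sup>2"] by (simp add: norm_power)
  also have "\<dots> \<le> (\<bar>y\<bar> + norm b)\<^sup>2" by (simp add: power2_sum)
  finally show ?thesis by (rule power2_le_imp_le) simp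
qed

lemma b_nonzero: "b \<noteq> 0" using Re_pos by auto

lemma norm_b_pos: "0 < norm b" using b_nonzero by simp

lemma hypotenuse_nonzero: "hypotenuse b y \<noteq> 0"
  using norm_hypotenuse_ge[of y] norm_b_pos by auto

lemma Re_hypotenuse_pos: "0 < Re (hypotenuse b y)"
  using hypotenuse_sector[of y] hypotenuse_nonzero[of y] by (auto simp: complex_eq_iff)

lemma hypotenuse_radicand_not_nonpos_Real: "(of_real y)\<^sup>2 + b\<^sup>2 \<notin> \<real>\<^sub>\<le>\<^sub>0"
proof
  assume "(of_real y)\<^sup>2 + b\<^sup>2 \<in> \<real>\<^sub>\<le>\<^sub>0"
  then have "Im (b\<^sup>2) = 0" "Re (b\<^sup>2) + y\<^sup>2 \<le> 0"
    by (auto simp: complex_nonpos_Reals_iff simp flip: of_real_power)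
  then have "Im (b\<^sup>2) = 0" "Re (b\<^sup>2) \<le> 0" using zero_le_power2[of y] by linarith+
  then have "Im b = 0" "(Re b)\<^sup>2 \<le> 0" using Re_pos by (auto simp: power2_eq_square)
  then show False using Re_pos by simp
qed

lemma continuous_hypotenuse: "continuous_on UNIV (hypotenuse b)"
  unfolding hypotenuse_def
  by (intro continuous_at_imp_continuous_on ballI isCont_o2[OF _ continuous_at_csqrt] hypotenuse_radicand_not_nonpos_Real)
     (auto intro!: continuous_intros)

lemma hypotenuse_0: "hypotenuse b 0 = b"
  using Re_pos by (simp add: hypotenuse_def csqrt_square)

lemma hypotenuse_plus_nonzero: "hypotenuse b y + b \<noteq> 0"
proof -
  have "0 < Re (hypotenuse b y + b)" using Re_hypotenuse_pos[of y] Re_pos by simp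
  then show ?thesis by (metis less_irrefl zero_complex.sel(1))
qed

lemma hypotenuse_minus: "hypotenuse b y - b = (of_real y)\<^sup>2 / (hypotenuse b y + b)"
proof -
  have "(hypotenuse b y - b) * (hypotenuse b y + b) = (of_real y)\<^sup>2"
    using hypotenuse_square[of b y] by (simp add: algebra_simps power2_eq_square)
  then show ?thesis using hypotenuse_plus_nonzero by (simp add: eq_divide_eq)
qed

text \<open>The exponent is \<open>l y\<^sup>2 / (hypotenuse b y + b)\<close>, quadratic for small \<open>y\<close> and linear for large \<open>y\<close>. A lower bound
that is linear in the rescaled variable \<open>sqrt l y\<close> is enough to dominate the integrand uniformly in \<open>l\<close>.\<close>

lemma Re_hypotenuse_minus_ge:
  assumes "1 \<le> l"
  shows "sqrt l * \<bar>y\<bar> / 2 - norm b \<le> l * Re (hypotenuse b y - b)"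
proof -
  let ?w = "hypotenuse b y + b"
  let ?m = "2 * norm b"
  have w_pos: "0 < norm ?w" using hypotenuse_plus_nonzero by simp
  have "norm ?w \<le> \<bar>Re ?w\<bar> + \<bar>Im ?w\<bar>" by (rule cmod_le)
  also have "\<dots> \<le> 2 * Re ?w"
    using hypotenuse_sector[of y] Im_le_Re by simp
  finally have w_Re: "norm ?w \<le> 2 * Re ?w" .
  have w_le: "norm ?w \<le> \<bar>y\<bar> + ?m"
    using norm_triangle_ineq[of "hypotenuse b y" b] norm_hypotenuse_le[of y] by simp
  have m: "0 < ?m" using norm_b_pos by simp
  then have pos: "0 < \<bar>y\<bar> + ?m" by linarith
  have s: "1 \<le> sqrt l" "sqrt l * sqrt l = l" using assms by auto
  have "(sqrt l * \<bar>y\<bar> - ?m) * (\<bar>y\<bar> + ?m) \<le> l * y\<^sup>2"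
  \<comment> \<open>for a nonpositive left factor the claim is trivial; otherwise \<open>|y| \<le> sqrt l |y|\<close> turns the product into a difference of squares\<close>
  proof (cases "sqrt l * \<bar>y\<bar> \<le> ?m")
    case True
    then have "(sqrt l * \<bar>y\<bar> - ?m) * (\<bar>y\<bar> + ?m) \<le> 0"
      using m by (intro mult_nonpos_nonneg) auto
    also have "0 \<le> l * y\<^sup>2" using assms by simp
    finally show ?thesis .
  next
    case False
    have "\<bar>y\<bar> \<le> sqrt l * \<bar>y\<bar>" using s(1) mult_right_mono[of 1 "sqrt l" "\<bar>y\<bar>"] by simp
    then have "(sqrt l * \<bar>y\<bar> - ?m) * (\<bar>y\<bar> + ?m) \<le> (sqrt l * \<bar>y\<bar> - ?m) * (sqrt l * \<bar>y\<bar> + ?m)"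
      using False by (intro mult_left_mono) auto
    also have "\<dots> = l * y\<^sup>2 - ?m\<^sup>2"
      using s(2) by (simp add: algebra_simps power2_eq_square) 
    finally show ?thesis using zero_le_power2[of ?m] by linarith
  qed
  then have "sqrt l * \<bar>y\<bar> - ?m \<le> l * y\<^sup>2 / (\<bar>y\<bar> + ?m)"
    by (rule mult_imp_le_div_pos[OF pos])
  also have "\<dots> \<le> l * y\<^sup>2 / norm ?w"
    using assms by (intro divide_left_mono[OF w_le] mult_pos_pos pos w_pos) auto
  also have "\<dots> \<le> l * (2 * (y\<^sup>2 * Re ?w / (norm ?w)\<^sup>2))"
  proof -
    have "l * y\<^sup>2 * norm ?w \<le> l * y\<^sup>2 * (2 * Re ?w)"
      using w_Re assms by (intro mult_left_mono) auto
    then have "l * y\<^sup>2 * norm ?w / (norm ?w)\<^sup>2 \<le> l * y\<^sup>2 * (2 * Re ?w) / (norm ?w)\<^sup>2"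
      by (rule divide_right_mono) simp
    then show ?thesis using w_pos by (simp add: power2_eq_square mult_ac)
  qed
  also have "y\<^sup>2 * Re ?w / (norm ?w)\<^sup>2 = Re (hypotenuse b y - b)"
    unfolding hypotenuse_minus by (simp add: Re_divide cmod_power2 flip: of_real_power)
  finally have "sqrt l * \<bar>y\<bar> - ?m \<le> l * (2 * Re (hypotenuse b y - b))" .
  then show ?thesis by (simp add: algebra_simps)
qed

lemma laplace_integrand_bound:
  assumes "1 \<le> l"
  shows "norm (exp (- of_real l * (hypotenuse b y - b)) / hypotenuse b y)
    \<le> 8 * exp (norm b) / norm b / (1 + (sqrt l * y)\<^sup>2)"
proof -
  let ?t = "sqrt l * \<bar>y\<bar>"
  have t: "0 \<le> ?t" "?t\<^sup>2 = (sqrt l * y)\<^sup>2"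
    using assms by (auto simp: power_mult_distrib)
  have "(1 + (sqrt l * y)\<^sup>2) / 8 \<le> exp (?t / 2)"
    using exp_lower_Taylor_quadratic[of "?t / 2"] t by (simp add: power_divide)
  then have "exp (- (?t / 2)) \<le> 8 / (1 + (sqrt l * y)\<^sup>2)"
    by (simp add: exp_minus divide_simps add_pos_nonneg)
  then have "exp (norm b) * exp (- (?t / 2)) \<le> exp (norm b) * (8 / (1 + (sqrt l * y)\<^sup>2))"
    by (intro mult_left_mono) auto
  moreover have "exp (- (l * Re (hypotenuse b y - b))) \<le> exp (norm b) * exp (- (?t / 2))"
    using Re_hypotenuse_minus_ge[OF assms, of y] by (simp flip: exp_add)
  ultimately have "exp (- (l * Re (hypotenuse b y - b))) \<le> exp (norm b) * (8 / (1 + (sqrt l * y)\<^sup>2))"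
    by (rule order_trans[rotated])
  then have "exp (- (l * Re (hypotenuse b y - b))) \<le> 8 * exp (norm b) / (1 + (sqrt l * y)\<^sup>2)"
    by (simp add: mult.commute)
  then have "exp (- (l * Re (hypotenuse b y - b))) / norm (hypotenuse b y)
      \<le> 8 * exp (norm b) / (1 + (sqrt l * y)\<^sup>2) / norm b"
    using norm_hypotenuse_ge[of y] norm_b_pos by (intro frac_le) (auto simp: add_pos_nonneg)
  then show ?thesis by (simp add: norm_divide mult.commute)
qed

lemma laplace_integrable:
  assumes "1 \<le> l"
  shows "integrable lborel (\<lambda>y. exp (- of_real l * (hypotenuse b y - b)) / hypotenuse b y)"
proof (rule integrable_dominated_by_inverse_square)
  show "(\<lambda>y. exp (- of_real l * (hypotenuse b y - b)) / hypotenuse b y) \<in> borel_measurable borel"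
    using hypotenuse_nonzero
    by (intro borel_measurable_continuous_onI continuous_intros continuous_hypotenuse) auto
  fix y :: real
  have "1 * y\<^sup>2 \<le> l * y\<^sup>2" using assms by (intro mult_right_mono) auto
  then have "1 + y\<^sup>2 \<le> 1 + (sqrt l * y)\<^sup>2" using assms by (simp add: power_mult_distrib)
  then have "8 * exp (norm b) / norm b / (1 + (sqrt l * y)\<^sup>2) \<le> 8 * exp (norm b) / norm b / (1 + y\<^sup>2)"
    by (intro divide_left_mono mult_pos_pos) (auto simp: add_pos_nonneg)
  with laplace_integrand_bound[OF assms]
  show "norm (exp (- of_real l * (hypotenuse b y - b)) / hypotenuse b y)
      \<le> 8 * exp (norm b) / norm b / (1 + y\<^sup>2)"
    by (rule order_trans)
qed

text \<open>Laplace's method as dominated convergence: after \<open>y = t / sqrt l\<close> the exponent converges pointwise to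
the complex Gaussian exponent \<open>- t\<^sup>2 / (2 b)\<close>.\<close>

lemma laplace_asymptotics:
  "((\<lambda>l. of_real (sqrt l) * (\<integral>y. exp (- of_real l * (hypotenuse b y - b)) / hypotenuse b y \<partial>lborel))
    \<longlongrightarrow> of_real (sqrt pi) / csqrt (1 / (2 * b)) / b) at_top"
proof -
  let ?f = "\<lambda>l y. exp (- of_real l * (hypotenuse b y - b)) / hypotenuse b y"
  have "((\<lambda>l. \<integral>t. ?f l (t / sqrt l) \<partial>lborel) \<longlongrightarrow>
      (\<integral>t. exp (- (1 / (2 * b)) * (of_real t)\<^sup>2) / b \<partial>lborel)) at_top"
  proof (rule integral_dominated_convergence_at_top)
    show "AE t in lborel. ((\<lambda>l. ?f l (t / sqrt l)) \<longlongrightarrow> exp (- (1 / (2 * b)) * (of_real t)\<^sup>2) / b) at_top"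
    proof (rule AE_I2)
      fix t :: real
      have "((\<lambda>l. t / sqrt l) \<longlongrightarrow> 0) at_top" by real_asymp
      then have "((\<lambda>l. hypotenuse b (t / sqrt l)) \<longlongrightarrow> hypotenuse b 0) at_top"
        using continuous_hypotenuse isCont_tendsto_compose
        by (metis continuous_on_eq_continuous_at open_UNIV UNIV_I)
      then have lim: "((\<lambda>l. hypotenuse b (t / sqrt l)) \<longlongrightarrow> b) at_top"
        by (simp add: hypotenuse_0)
      then have "((\<lambda>l. exp (- ((of_real t)\<^sup>2 / (hypotenuse b (t / sqrt l) + b))) / hypotenuse b (t / sqrt l))
          \<longlongrightarrow> exp (- ((of_real t)\<^sup>2 / (b + b))) / b) at_top"
        using b_nonzero by (intro tendsto_intros) auto
      moreover have "\<forall>\<^sub>F l in at_top. exp (- ((of_real t)\<^sup>2 / (hypotenuse b (t / sqrt l) + b)))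
          / hypotenuse b (t / sqrt l) = ?f l (t / sqrt l)"
        using eventually_gt_at_top[of 0]
      proof eventually_elim
        case (elim l)
        then have "l * (t / sqrt l)\<^sup>2 = t\<^sup>2" by (simp add: power_divide)
        then have "of_real l * (of_real (t / sqrt l))\<^sup>2 = (of_real t :: complex)\<^sup>2"
          by (metis of_real_mult of_real_power)
        then show ?case unfolding hypotenuse_minus by (simp add: mult.assoc)
      qed
      ultimately have "((\<lambda>l. ?f l (t / sqrt l)) \<longlongrightarrow> exp (- ((of_real t)\<^sup>2 / (b + b))) / b) at_top"
        by (rule Lim_transform_eventually)
      then show "((\<lambda>l. ?f l (t / sqrt l)) \<longlongrightarrow> exp (- (1 / (2 * b)) * (of_real t)\<^sup>2) / b) at_top"
        by (simp flip: mult_2)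
    qed
    show "\<forall>\<^sub>F l in at_top. AE t in lborel. norm (?f l (t / sqrt l)) \<le> 8 * exp (norm b) / norm b / (1 + t\<^sup>2)"
      using eventually_ge_at_top[of 1]
    proof eventually_elim
      case (elim l)
      show ?case using laplace_integrand_bound[OF elim, of "t / sqrt l" for t] elim by simp
    qed
    show "(\<lambda>t. ?f l (t / sqrt l)) \<in> borel_measurable lborel" for l
    proof -
      have "?f l \<in> borel_measurable borel"
        using hypotenuse_nonzero
        by (intro borel_measurable_continuous_onI continuous_intros continuous_hypotenuse) auto
      then show ?thesis by measurable
    qed
    show "integrable lborel (\<lambda>t. 8 * exp (norm b) / norm b / (1 + t\<^sup>2))"
      by (rule integrable_inverse_one_plus_square)
  qed simp
  moreover have "\<forall>\<^sub>F l in at_top. (\<integral>t. ?f l (t / sqrt l) \<partial>lborel) = of_real (sqrt l) * (\<integral>y. ?f l y \<partial>lborel)"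
    using eventually_gt_at_top[of 0]
  proof eventually_elim
    case (elim l)
    then show ?case
      using lborel_integral_real_affine[of "1 / sqrt l" "?f l" 0]
      by (simp add: scaleR_conv_of_real)
  qed
  ultimately have "((\<lambda>l. of_real (sqrt l) * (\<integral>y. ?f l y \<partial>lborel)) \<longlongrightarrow>
      (\<integral>t. exp (- (1 / (2 * b)) * (of_real t)\<^sup>2) / b \<partial>lborel)) at_top"
    by (rule Lim_transform_eventually)
  moreover have "(\<integral>t. exp (- (1 / (2 * b)) * (of_real t)\<^sup>2) / b \<partial>lborel)
      = of_real (sqrt pi) / csqrt (1 / (2 * b)) / b"
  proof -
    have "0 < Re (1 / (2 * b))" using Re_pos
      by (simp add: Re_divide) (intro divide_pos_pos add_pos_nonneg; simp)
    from integral_gaussian_complex[OF this] show ?thesis by (simp only: integral_divide_zero)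
  qed
  ultimately show ?thesis by (simp only:)
qed

end

section \<open>Reduction to Bessel integrals\<close>

text \<open>This is \<open>2 K\<^sub>0(l b)\<close> with the modified Bessel function \<open>K\<^sub>0\<close>, as the substitution \<open>y = b sinh t\<close> shows.\<close>

definition bessel_integral :: "complex \<Rightarrow> real \<Rightarrow> complex" where
  "bessel_integral b l = (\<integral>y. exp (- of_real l * hypotenuse b y) / hypotenuse b y \<partial>lborel)"

context sector
begin

lemma bessel_integrand_factor:
  "exp (- of_real l * hypotenuse b y) / hypotenuse b y
    = exp (- of_real l * b) * (exp (- of_real l * (hypotenuse b y - b)) / hypotenuse b y)"
proof -
  have "exp (- of_real l * hypotenuse b y) = exp (- of_real l * b) * exp (- of_real l * (hypotenuse b y - b))"
    unfolding exp_add[symmetric] by (simp add: algebra_simps)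
  then show ?thesis by simp
qed

lemma bessel_integrable:
  assumes "1 \<le> l"
  shows "integrable lborel (\<lambda>y. exp (- of_real l * hypotenuse b y) / hypotenuse b y)"
proof -
  have "integrable lborel (\<lambda>y. exp (- of_real l * b) * (exp (- of_real l * (hypotenuse b y - b)) / hypotenuse b y))"
    by (rule integrable_mult_right) (rule laplace_integrable[OF assms])
  then show ?thesis by (simp only: bessel_integrand_factor)
qed

lemma bessel_integral_asymptotics:
  "((\<lambda>l. of_real (sqrt l) * exp (of_real l * b) * bessel_integral b l)
    \<longlongrightarrow> of_real (sqrt pi) / csqrt (1 / (2 * b)) / b) at_top"
proof -
  have inv: "exp (of_real l * b) * exp (- of_real l * b) = 1" for l
    by (simp flip: exp_add)
  have cancel: "c * exp (of_real l * b) * (exp (- of_real l * b) * X) = c * X" for c X :: complex and l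
  proof -
    have "c * exp (of_real l * b) * (exp (- of_real l * b) * X)
        = c * (exp (of_real l * b) * exp (- of_real l * b)) * X"
      by (simp only: mult.assoc)
    then show ?thesis by (simp only: inv mult_1_right)
  qed
  have eq: "of_real (sqrt l) * exp (of_real l * b) * bessel_integral b l
      = of_real (sqrt l) * (\<integral>y. exp (- of_real l * (hypotenuse b y - b)) / hypotenuse b y \<partial>lborel)" for l
    unfolding bessel_integral_def bessel_integrand_factor integral_mult_right_zero
    by (rule cancel)
  show ?thesis unfolding eq by (rule laplace_asymptotics)
qed

end

text \<open>The height above the real axis of the singularities that are lowest; it is the exponential rate
of decay of the transform.\<close>

definition pole_height :: real where
  "pole_height = sqrt (pi / 2)"

definition upper_root :: complex where
  "upper_root = Complex pole_height pole_height"

definition lower_root :: complex where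
  "lower_root = Complex pole_height (- pole_height)"

lemma pole_height_bounds: "0 < pole_height" "pole_height < 3 / 2"
proof -
  show "0 < pole_height" by (simp add: pole_height_def)
  have "pi / 2 < (3 / 2)\<^sup>2" using pi_less_4 by (simp add: power2_eq_square)
  then have "sqrt (pi / 2) < sqrt ((3 / 2)\<^sup>2)" by (rule real_sqrt_less_mono)
  then show "pole_height < 3 / 2" by (simp add: pole_height_def)
qed

lemma pole_height_square: "pole_height * pole_height = pi / 2"
  unfolding pole_height_def by (simp only: real_sqrt_mult_self) simp

lemma root_squares: "upper_root\<^sup>2 = \<i> * of_real pi" "lower_root\<^sup>2 = - (\<i> * of_real pi)"
  by (simp_all add: upper_root_def lower_root_def complex_eq_iff power2_eq_square pole_height_square)

interpretation upper: sector upper_root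
  using pole_height_bounds by unfold_locales (simp_all add: upper_root_def)

interpretation lower: sector lower_root
  using pole_height_bounds by unfold_locales (simp_all add: lower_root_def)

interpretation two: sector 2
  by unfold_locales simp_all

lemma Complex_in_parabola_region:
  assumes "0 \<le> b" "b \<le> 3 / 2"
  shows "(Complex x b)\<^sup>2 + (of_real y)\<^sup>2 \<in> parabola_region"
proof -
  have b2: "b\<^sup>2 \<le> 9 / 4" using power_mono[of b "3 / 2" 2] assms by (simp add: power_divide)
  have "(2 * x * b)\<^sup>2 = (4 * b\<^sup>2) * x\<^sup>2" by (simp add: power_mult_distrib)
  also have "\<dots> \<le> 9 * x\<^sup>2" using b2 by (intro mult_right_mono) auto
  also have "\<dots> \<le> 9 * (x\<^sup>2 - b\<^sup>2 + y\<^sup>2 + 9 / 4)"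
    using b2 by (intro mult_left_mono) (auto simp: add_increasing)
  finally have "(2 * x * b)\<^sup>2 \<le> 9 * (x\<^sup>2 - b\<^sup>2 + y\<^sup>2 + 9 / 4)" .
  then show ?thesis
    unfolding parabola_region_def by (simp add: power2_eq_square mult_ac)
qed

lemma strip_in_fermi_domain:
  assumes "- 1 < Im w" "Im w < 2"
  shows "w\<^sup>2 + (of_real y)\<^sup>2 \<in> fermi_domain"
proof -
  define x b where "x = Re w" and "b = Im w"
  have b: "\<bar>b\<bar> < 2" using assms by (auto simp: b_def)
  then have b2: "b\<^sup>2 < 4" using power_strict_mono[of "\<bar>b\<bar>" 2 2] by simp
  have Re: "Re (w\<^sup>2 + (of_real y)\<^sup>2) = x\<^sup>2 - b\<^sup>2 + y\<^sup>2"
    and Im: "Im (w\<^sup>2 + (of_real y)\<^sup>2) = 2 * x * b"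
    by (simp_all add: x_def b_def power2_eq_square)
  have "0 < x\<^sup>2 - b\<^sup>2" if "3 * pi \<le> \<bar>2 * x * b\<bar>"
  proof -
    have "9 < 2 * \<bar>x\<bar> * \<bar>b\<bar>" using that pi_gt3 by (simp add: abs_mult)
    also have "\<dots> \<le> 2 * \<bar>x\<bar> * 2" using b by (intro mult_left_mono) auto
    finally have "2 < \<bar>x\<bar>" by simp
    then have "4 < x\<^sup>2" using power_strict_mono[of 2 "\<bar>x\<bar>" 2] by simp
    with b2 show ?thesis by simp
  qed
  then show ?thesis
    unfolding fermi_domain_def mem_Collect_eq Re Im
    using b2 zero_le_power2[of x] zero_le_power2[of y] by (smt (verit))
qed

lemma norm_plus_4_ge:
  assumes "0 \<le> b" "b \<le> 3 / 2"
  shows "(1 + x\<^sup>2) * (1 + y\<^sup>2) \<le> (norm ((Complex x b)\<^sup>2 + (of_real y)\<^sup>2 + 4))\<^sup>2"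
proof -
  have b2: "b\<^sup>2 \<le> 9 / 4" using power_mono[of b "3 / 2" 2] assms by (simp add: power_divide)
  have "(1 + x\<^sup>2) * (1 + y\<^sup>2) \<le> (1 + x\<^sup>2 + y\<^sup>2) * (1 + x\<^sup>2 + y\<^sup>2)"
    by (intro mult_mono) auto
  also have "1 + x\<^sup>2 + y\<^sup>2 \<le> Re ((Complex x b)\<^sup>2 + (of_real y)\<^sup>2 + 4)"
    using b2 by (simp add: power2_eq_square)
  then have "1 + x\<^sup>2 + y\<^sup>2 \<le> norm ((Complex x b)\<^sup>2 + (of_real y)\<^sup>2 + 4)"
    using complex_Re_le_cmod order_trans by blast
  then have "(1 + x\<^sup>2 + y\<^sup>2) * (1 + x\<^sup>2 + y\<^sup>2) \<le> (norm ((Complex x b)\<^sup>2 + (of_real y)\<^sup>2 + 4))\<^sup>2"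
    unfolding power2_eq_square[of "norm _"] by (intro mult_mono) auto
  finally show ?thesis .
qed

text \<open>For each \<open>y\<close> the holomorphic remainder is shifted to the line \<open>Im x = 3/2\<close>, and the three simple fractions are
transformed exactly. The height \<open>3/2\<close> lies above \<open>sqrt (\<pi> / 2)\<close> and below every other singularity, for all
\<open>y\<close> at once, and the error is integrable in \<open>y\<close>.\<close>

lemma fermi_fourier_transform:
  obtains C where "\<And>l y. 0 < l \<Longrightarrow>
    norm ((\<integral>x. exp (\<i> * of_real (l * x)) / of_real (1 + exp (x\<^sup>2 + y\<^sup>2)) \<partial>lborel)
      - of_real pi * (2 * (exp (- of_real l * hypotenuse 2 y) / hypotenuse 2 y)
        - exp (- of_real l * hypotenuse upper_root y) / hypotenuse upper_root y
        - exp (- of_real l * hypotenuse lower_root y) / hypotenuse lower_root y))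
    \<le> C * exp (- (3 / 2 * l)) / (1 + y\<^sup>2)"
proof -
  obtain H C where H_holo: "H holomorphic_on fermi_domain"
    and H: "\<And>z. z \<in> fermi_domain \<Longrightarrow> z \<noteq> \<i> * of_real pi \<Longrightarrow> z \<noteq> - (\<i> * of_real pi) \<Longrightarrow>
      1 / (1 + exp z) = H z - (1 / (z - \<i> * of_real pi) + 1 / (z + \<i> * of_real pi)) + 2 / (z + 4)"
    and H_bound: "\<And>z. z \<in> parabola_region \<Longrightarrow> norm (H z) \<le> C / (norm (z + 4))\<^sup>2"
    by (rule fermi_function_remainder) (rule that)
  let ?I = "\<integral>x. 1 / (1 + x\<^sup>2) \<partial>lborel"
  have C: "0 \<le> C"
  proof -
    have "norm (H 0) \<le> C / (norm ((0::complex) + 4))\<^sup>2"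
      by (rule H_bound) (simp add: parabola_region_def)
    then have "norm (H 0) * 16 \<le> C" by simp
    with norm_ge_zero[of "H 0"] show ?thesis by linarith
  qed
  have main: "norm ((\<integral>x. exp (\<i> * of_real (l * x)) / of_real (1 + exp (x\<^sup>2 + y\<^sup>2)) \<partial>lborel)
      - of_real pi * (2 * (exp (- of_real l * hypotenuse 2 y) / hypotenuse 2 y)
        - exp (- of_real l * hypotenuse upper_root y) / hypotenuse upper_root y
        - exp (- of_real l * hypotenuse lower_root y) / hypotenuse lower_root y))
    \<le> C * ?I * exp (- (3 / 2 * l)) / (1 + y\<^sup>2)" if l: "0 < l" for l y
  proof -
    define f where "f = (\<lambda>w. exp (\<i> * of_real l * w) * H (w\<^sup>2 + (of_real y)\<^sup>2))"
    \<comment> \<open>heights below \<open>2\<close> keep \<open>w\<^sup>2 + y\<^sup>2\<close> to the right of \<open>- 4\<close>\<close>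
    define S where "S = {w. - 1 < Im w} \<inter> {w. Im w < 2}"
    have S: "open S" "convex S"
      unfolding S_def by (intro open_Int open_halfspace_Im_gt open_halfspace_Im_lt
        convex_Int convex_halfspace_Im_gt convex_halfspace_Im_lt)+
    have f_holo: "f holomorphic_on S"
    proof -
      have "(H \<circ> (\<lambda>w. w\<^sup>2 + (of_real y)\<^sup>2)) holomorphic_on S"
        by (rule holomorphic_on_compose_gen[OF _ H_holo])
           (auto intro!: holomorphic_intros strip_in_fermi_domain simp: S_def)
      then show ?thesis unfolding f_def o_def by (intro holomorphic_intros)
    qed
    have f_norm: "norm (f (Complex x b)) \<le> exp (- (l * b)) * (C / (1 + y\<^sup>2)) / (1 + x\<^sup>2)"
      if b: "0 \<le> b" "b \<le> 3 / 2" for x b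
    proof -
      have pos: "0 < (1 + x\<^sup>2) * (1 + y\<^sup>2)" by (simp add: add_pos_nonneg)
      have "norm (H ((Complex x b)\<^sup>2 + (of_real y)\<^sup>2)) \<le> C / (norm ((Complex x b)\<^sup>2 + (of_real y)\<^sup>2 + 4))\<^sup>2"
        using H_bound[OF Complex_in_parabola_region[OF b]] .
      also have "\<dots> \<le> C / ((1 + x\<^sup>2) * (1 + y\<^sup>2))"
        using order_less_le_trans[OF pos norm_plus_4_ge[OF b]]
        by (intro divide_left_mono norm_plus_4_ge[OF b] C mult_pos_pos[OF _ pos])
      also have "\<dots> = C / (1 + y\<^sup>2) / (1 + x\<^sup>2)" by simp
      finally have "exp (- (l * b)) * norm (H ((Complex x b)\<^sup>2 + (of_real y)\<^sup>2))
          \<le> exp (- (l * b)) * (C / (1 + y\<^sup>2) / (1 + x\<^sup>2))"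
        by (rule mult_left_mono) simp
      then show ?thesis by (simp add: f_def norm_mult)
    qed
    have f_norm': "norm (f (Complex x b)) \<le> C / (1 + y\<^sup>2) / (1 + x\<^sup>2)" if b: "0 \<le> b" "b \<le> 3 / 2" for x b
    proof -
      have "0 \<le> C / (1 + y\<^sup>2)" using C by simp
      then have "exp (- (l * b)) * (C / (1 + y\<^sup>2)) \<le> 1 * (C / (1 + y\<^sup>2))"
        using l b by (intro mult_right_mono) auto
      then have "exp (- (l * b)) * (C / (1 + y\<^sup>2)) / (1 + x\<^sup>2) \<le> 1 * (C / (1 + y\<^sup>2)) / (1 + x\<^sup>2)"
        by (rule divide_right_mono) simp
      with f_norm[OF b, of x] show ?thesis by simp
    qed
    have sub: "w \<in> S" if "0 \<le> Im w" "Im w \<le> 3 / 2" for w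
      using that by (simp add: S_def)
    note shift = integral_horizontal_shift[OF S sub _ f_holo f_norm', of "3 / 2"]
    have f_int: "integrable lborel (\<lambda>x. f (of_real x))"
      by (rule shift(1)) auto
    have f_eq: "(\<integral>x. f (of_real x) \<partial>lborel) = (\<integral>x. f (Complex x (3 / 2)) \<partial>lborel)"
      by (rule shift(2)) auto
    have "norm (\<integral>x. f (Complex x (3 / 2)) \<partial>lborel)
        \<le> (\<integral>x. exp (- (l * (3 / 2))) * (C / (1 + y\<^sup>2)) / (1 + x\<^sup>2) \<partial>lborel)"
    proof (rule Bochner_Integration.integral_norm_bound_integral)
      show "integrable lborel (\<lambda>x. f (Complex x (3 / 2)))"
      proof (rule integrable_dominated_by_inverse_square[of _ "C / (1 + y\<^sup>2)"])
        show "(\<lambda>x. f (Complex x (3 / 2))) \<in> borel_measurable borel"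
          by (intro borel_measurable_continuous_onI continuous_on_horizontal_line[OF f_holo S(1)])
             (simp add: S_def)
        show "norm (f (Complex x (3 / 2))) \<le> C / (1 + y\<^sup>2) / (1 + x\<^sup>2)" for x
          by (rule f_norm') auto
      qed
      show "integrable lborel (\<lambda>x. exp (- (l * (3 / 2))) * (C / (1 + y\<^sup>2)) / (1 + x\<^sup>2))"
        by (rule integrable_inverse_one_plus_square)
      show "norm (f (Complex x (3 / 2))) \<le> exp (- (l * (3 / 2))) * (C / (1 + y\<^sup>2)) / (1 + x\<^sup>2)" for x
        by (rule f_norm) auto
    qed
    also have "\<dots> = exp (- (l * (3 / 2))) * (C / (1 + y\<^sup>2)) * ?I"
      by (subst integral_mult_right_zero[symmetric]) simp
    finally have f_small: "norm (\<integral>x. f (of_real x) \<partial>lborel) \<le> C * ?I * exp (- (3 / 2 * l)) / (1 + y\<^sup>2)"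
      unfolding f_eq by (simp add: mult_ac)
    let ?g = "\<lambda>a x. exp (\<i> * of_real (l * x)) / ((of_real x)\<^sup>2 + a\<^sup>2)"
    have split: "exp (\<i> * of_real (l * x)) / of_real (1 + exp (x\<^sup>2 + y\<^sup>2))
        = f (of_real x) + (2 * ?g (hypotenuse 2 y) x - ?g (hypotenuse upper_root y) x
            - ?g (hypotenuse lower_root y) x)" for x
    proof -
      define z where "z = complex_of_real (x\<^sup>2 + y\<^sup>2)"
      have z: "z = (of_real x)\<^sup>2 + (of_real y)\<^sup>2" by (simp add: z_def)
      have dom: "z \<in> fermi_domain" unfolding z by (rule strip_in_fermi_domain) auto
      have "z \<noteq> \<i> * of_real pi" "z \<noteq> - (\<i> * of_real pi)" by (auto simp: z_def complex_eq_iff)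
      note Hz = H[OF dom this]
      have poles: "z + 4 = (of_real x)\<^sup>2 + (hypotenuse 2 y)\<^sup>2"
        "z + \<i> * of_real pi = (of_real x)\<^sup>2 + (hypotenuse upper_root y)\<^sup>2"
        "z - \<i> * of_real pi = (of_real x)\<^sup>2 + (hypotenuse lower_root y)\<^sup>2"
        unfolding hypotenuse_square root_squares z by simp_all
      let ?e = "exp (\<i> * of_real (l * x))"
      have fx: "f (of_real x) = ?e * H z" by (simp add: f_def z mult.assoc)
      have "complex_of_real (1 + exp (x\<^sup>2 + y\<^sup>2)) = 1 + exp z"
        unfolding z_def exp_of_real by (simp only: of_real_add of_real_1)
      then have "?e / of_real (1 + exp (x\<^sup>2 + y\<^sup>2)) = ?e * (1 / (1 + exp z))"
        by simp
      also have "\<dots> = f (of_real x) + (2 * (?e / (z + 4)) - ?e / (z + \<i> * of_real pi) - ?e / (z - \<i> * of_real pi))"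
        unfolding Hz fx by (simp add: right_diff_distrib distrib_left)
      finally show ?thesis by (simp only: poles)
    qed
    note four2 = fourier_inverse_square_plus_square[OF two.Re_hypotenuse_pos l]
    note four_u = fourier_inverse_square_plus_square[OF upper.Re_hypotenuse_pos l]
    note four_l = fourier_inverse_square_plus_square[OF lower.Re_hypotenuse_pos l]
    have "(\<integral>x. exp (\<i> * of_real (l * x)) / of_real (1 + exp (x\<^sup>2 + y\<^sup>2)) \<partial>lborel)
        = (\<integral>x. f (of_real x) \<partial>lborel) + (2 * (\<integral>x. ?g (hypotenuse 2 y) x \<partial>lborel)
          - (\<integral>x. ?g (hypotenuse upper_root y) x \<partial>lborel) - (\<integral>x. ?g (hypotenuse lower_root y) x \<partial>lborel))"
      unfolding split using f_int four2(1)[of y] four_u(1)[of y] four_l(1)[of y]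
      by (simp only: Bochner_Integration.integral_add Bochner_Integration.integral_diff
          Bochner_Integration.integrable_diff integrable_mult_right integral_mult_right_zero)
    also have "\<dots> = (\<integral>x. f (of_real x) \<partial>lborel)
      + of_real pi * (2 * (exp (- of_real l * hypotenuse 2 y) / hypotenuse 2 y)
        - exp (- of_real l * hypotenuse upper_root y) / hypotenuse upper_root y
        - exp (- of_real l * hypotenuse lower_root y) / hypotenuse lower_root y)"
      unfolding four2(2) four_u(2) four_l(2) by (simp only: times_divide_eq_right right_diff_distrib mult.left_commute)
    finally have "(\<integral>x. exp (\<i> * of_real (l * x)) / of_real (1 + exp (x\<^sup>2 + y\<^sup>2)) \<partial>lborel)
      - of_real pi * (2 * (exp (- of_real l * hypotenuse 2 y) / hypotenuse 2 y)
        - exp (- of_real l * hypotenuse upper_root y) / hypotenuse upper_root y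
        - exp (- of_real l * hypotenuse lower_root y) / hypotenuse lower_root y)
      = (\<integral>x. f (of_real x) \<partial>lborel)"
      by (simp only: add_diff_cancel_right')
    then show ?thesis using f_small by (simp only:)
  qed
  show thesis by (rule that[OF main])
qed

lemma S_star_bessel:
  obtains C where "\<And>l. 1 \<le> l \<Longrightarrow>
    norm (S_star l - (bessel_integral upper_root l + bessel_integral lower_root l - 2 * bessel_integral 2 l))
      \<le> C * exp (- (3 / 2 * l))"
proof -
  let ?g = "\<lambda>l b y. exp (- of_real l * hypotenuse b y) / hypotenuse b y"
  let ?P = "\<lambda>l y. of_real pi * (2 * ?g l 2 y - ?g l upper_root y - ?g l lower_root y)"
  let ?F = "\<lambda>l y. \<integral>x. exp (\<i> * of_real (l * x)) / of_real (1 + exp (x\<^sup>2 + y\<^sup>2)) \<partial>lborel"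
  obtain C where C: "\<And>l y. 0 < l \<Longrightarrow> norm (?F l y - ?P l y) \<le> C * exp (- (3 / 2 * l)) / (1 + y\<^sup>2)"
    by (rule fermi_fourier_transform) (rule that)
  let ?I = "\<integral>x. 1 / (1 + x\<^sup>2) \<partial>lborel"
  have main: "norm (S_star l - (bessel_integral upper_root l + bessel_integral lower_root l - 2 * bessel_integral 2 l))
      \<le> C * ?I / pi * exp (- (3 / 2 * l))" if l: "1 \<le> l" for l
  proof -
    have l0: "0 < l" using l by simp
    note ints = two.bessel_integrable[OF l] upper.bessel_integrable[OF l] lower.bessel_integrable[OF l]
    have P_int: "integrable lborel (?P l)"
      using ints by (intro integrable_mult_right Bochner_Integration.integrable_diff)
    have "?F l \<in> borel_measurable lborel"
      by (rule lborel.borel_measurable_lebesgue_integral) measurable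
    then have E_int: "integrable lborel (\<lambda>y. ?F l y - ?P l y)"
      using P_int by (intro integrable_dominated_by_inverse_square[OF _ C[OF l0]]) auto
    have "(\<integral>y. ?F l y \<partial>lborel) = (\<integral>y. (?F l y - ?P l y) + ?P l y \<partial>lborel)"
      by (simp only: diff_add_cancel)
    also have "\<dots> = (\<integral>y. ?F l y - ?P l y \<partial>lborel) + (\<integral>y. ?P l y \<partial>lborel)"
      by (rule Bochner_Integration.integral_add[OF E_int P_int])
    also have "(\<integral>y. ?P l y \<partial>lborel)
        = of_real pi * (2 * bessel_integral 2 l - bessel_integral upper_root l - bessel_integral lower_root l)"
      unfolding bessel_integral_def using ints
      by (simp only: Bochner_Integration.integral_diff Bochner_Integration.integrable_diff
          integrable_mult_right integral_mult_right_zero)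
    finally have F_eq: "(\<integral>y. ?F l y \<partial>lborel) = (\<integral>y. ?F l y - ?P l y \<partial>lborel)
        + of_real pi * (2 * bessel_integral 2 l - bessel_integral upper_root l - bessel_integral lower_root l)" .
    have diff: "S_star l - (bessel_integral upper_root l + bessel_integral lower_root l - 2 * bessel_integral 2 l)
        = - (1 / of_real pi) * (\<integral>y. ?F l y - ?P l y \<partial>lborel)"
    proof -
      have "- (1 / of_real pi) * (J + of_real pi * (2 * t - u - v)) - (u + v - 2 * t)
          = - (1 / of_real pi) * J" for J t u v :: complex
        by (simp add: field_simps)
      then show ?thesis
        unfolding S_star_def F_eq by (simp only:)
    qed
    have "norm (\<integral>y. ?F l y - ?P l y \<partial>lborel) \<le> (\<integral>y. C * exp (- (3 / 2 * l)) / (1 + y\<^sup>2) \<partial>lborel)"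
      by (intro Bochner_Integration.integral_norm_bound_integral E_int integrable_inverse_one_plus_square C[OF l0])
    moreover have "(\<integral>y. C * exp (- (3 / 2 * l)) / (1 + y\<^sup>2) \<partial>lborel) = C * exp (- (3 / 2 * l)) * ?I"
      by (subst integral_mult_right_zero[symmetric]) simp
    ultimately have "norm (\<integral>y. ?F l y - ?P l y \<partial>lborel) \<le> C * exp (- (3 / 2 * l)) * ?I"
      by (simp only:)
    then have "1 / pi * norm (\<integral>y. ?F l y - ?P l y \<partial>lborel) \<le> 1 / pi * (C * exp (- (3 / 2 * l)) * ?I)"
      by (rule mult_left_mono) simp
    also have "\<dots> = C * ?I / pi * exp (- (3 / 2 * l))" by simp
    also have "1 / pi * norm (\<integral>y. ?F l y - ?P l y \<partial>lborel)
        = norm (- (1 / of_real pi) * (\<integral>y. ?F l y - ?P l y \<partial>lborel))"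
      by (simp only: norm_mult norm_minus_cancel norm_divide norm_one norm_of_real) simp
    finally show ?thesis unfolding diff .
  qed
  show thesis by (rule that[OF main])
qed

section \<open>The asymptotic formula\<close>

text \<open>The Laplace constant has square \<open>2 \<pi> / b\<close>; for \<open>b = sqrt \<pi> cis (2 t)\<close> the principal square root halves the
argument, which is the origin of the phase \<open>\<pi> / 8\<close>.\<close>

lemma laplace_constant:
  assumes "\<bar>t\<bar> < pi / 2"
  shows "of_real (sqrt pi) / csqrt (1 / (2 * (of_real (sqrt pi) * cis (2 * t)))) / (of_real (sqrt pi) * cis (2 * t))
    = of_real (sqrt (2 * sqrt pi)) * cis (- t)"
proof -
  define k where "k = sqrt (2 * sqrt pi)"
  have k: "0 < k" "k\<^sup>2 = 2 * sqrt pi" by (simp_all add: k_def)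
  have "csqrt (1 / (2 * (of_real (sqrt pi) * cis (2 * t)))) = cis (- t) / of_real k"
  proof (rule csqrt_unique)
    have "(cis (- t) / of_real k)\<^sup>2 = cis (- (2 * t)) / of_real (k\<^sup>2)"
      by (simp add: power_divide Complex.DeMoivre)
    also have "\<dots> = 1 / (2 * (of_real (sqrt pi) * cis (2 * t)))"
      unfolding k(2) by (simp flip: cis_inverse add: divide_simps)
    finally show "(cis (- t) / of_real k)\<^sup>2 = 1 / (2 * (of_real (sqrt pi) * cis (2 * t)))" .
    have "0 < cos t" using assms by (intro cos_gt_zero_pi) auto
    then show "0 < Re (cis (- t) / of_real k) \<or> Re (cis (- t) / of_real k) = 0 \<and> 0 \<le> Im (cis (- t) / of_real k)"
      using k(1) by simp
  qed
  moreover have "cis (2 * t) = cis t * cis t" by (simp add: cis_mult)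
  moreover have "cis (- t) * cis t = 1" by (simp add: cis_mult)
  ultimately show ?thesis
    using k(1) unfolding k_def[symmetric] by (simp add: divide_simps mult_ac flip: cis_inverse)
qed

lemma roots_polar:
  "upper_root = of_real (sqrt pi) * cis (2 * (pi / 8))"
  "lower_root = of_real (sqrt pi) * cis (2 * (- (pi / 8)))"
proof -
  have "pole_height = sqrt pi * (sqrt 2 / 2)"
    by (simp add: pole_height_def real_sqrt_divide field_simps)
  then show "upper_root = of_real (sqrt pi) * cis (2 * (pi / 8))"
    "lower_root = of_real (sqrt pi) * cis (2 * (- (pi / 8)))"
    by (simp_all add: upper_root_def lower_root_def complex_eq_iff cos_45 sin_45)
qed

text \<open>The amplitude \<open>exp (l Re b)\<close> is split off and the oscillating factor \<open>cis (- l Im b)\<close> is moved to the main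
term; having modulus one, it does not affect the convergence to zero.\<close>

lemma bessel_integral_rotated:
  assumes b: "b = of_real (sqrt pi) * cis (2 * t)" "sector b" "\<bar>t\<bar> < pi / 2"
    and Re: "Re b = pole_height"
  shows "((\<lambda>l. of_real (sqrt l * exp (l * pole_height)) * bessel_integral b l
      - of_real (sqrt (2 * sqrt pi)) * cis (- (t + l * Im b))) \<longlongrightarrow> 0) at_top"
proof -
  interpret sector b by (rule b(2))
  let ?c = "complex_of_real (sqrt (2 * sqrt pi))"
  have "((\<lambda>l. of_real (sqrt l) * exp (of_real l * b) * bessel_integral b l) \<longlongrightarrow> ?c * cis (- t)) at_top"
    using bessel_integral_asymptotics unfolding b(1) laplace_constant[OF b(3)] .
  then have "((\<lambda>l. of_real (sqrt l) * exp (of_real l * b) * bessel_integral b l - ?c * cis (- t)) \<longlongrightarrow> 0) at_top"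
    by (simp add: LIM_zero_iff)
  then have lim: "((\<lambda>l. norm (of_real (sqrt l) * exp (of_real l * b) * bessel_integral b l - ?c * cis (- t)))
      \<longlongrightarrow> 0) at_top"
    by (rule tendsto_norm_zero)
  have eq: "of_real (sqrt l * exp (l * pole_height)) * bessel_integral b l - ?c * cis (- (t + l * Im b))
      = cis (- (l * Im b)) * (of_real (sqrt l) * exp (of_real l * b) * bessel_integral b l - ?c * cis (- t))" for l
  proof -
    have "exp (of_real l * b) = of_real (exp (l * pole_height)) * cis (l * Im b)"
      unfolding exp_eq_polar[of "of_real l * b"] by (simp add: Re)
    then have "cis (- (l * Im b)) * exp (of_real l * b) = of_real (exp (l * pole_height))"
      by (simp add: mult.left_commute cis_mult)
    moreover have "cis (- (t + l * Im b)) = cis (- (l * Im b)) * cis (- t)"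
      by (simp add: cis_mult add.commute)
    ultimately show ?thesis
      by (simp add: right_diff_distrib mult_ac)
  qed
  show ?thesis
    unfolding eq by (rule tendsto_norm_zero_cancel) (use lim in \<open>simp add: norm_mult\<close>)
qed

theorem mainTheorem2:
  shows "(\<lambda>l::real. S_star l -
            complex_of_real (2 powr (3/2) * pi powr (1/4) * exp (- l * sqrt (pi/2)) *
              (cos (l * sqrt (pi/2) + pi/8) / l powr (1/2))))
         \<in> o[at_top](\<lambda>l. complex_of_real (l powr (-1/2) * exp (- l * sqrt (pi/2))))"
proof (rule smalloI_tendsto)
  define s where "s = pole_height"
  have s: "0 < s" "s < 3 / 2" using pole_height_bounds by (simp_all add: s_def)
  let ?k = "sqrt (2 * sqrt pi)"
  let ?g = "\<lambda>l. complex_of_real (sqrt l * exp (l * s))"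
  let ?B = "\<lambda>l. bessel_integral upper_root l + bessel_integral lower_root l - 2 * bessel_integral 2 l"
  let ?main = "\<lambda>l. 2 powr (3/2) * pi powr (1/4) * exp (- l * sqrt (pi/2)) *
              (cos (l * sqrt (pi/2) + pi/8) / l powr (1/2))"
  have upper: "((\<lambda>l. ?g l * bessel_integral upper_root l - of_real ?k * cis (- (l * s + pi / 8))) \<longlongrightarrow> 0) at_top"
    using bessel_integral_rotated[OF roots_polar(1) upper.sector_axioms]
    by (simp add: upper_root_def s_def add.commute)
  have lower: "((\<lambda>l. ?g l * bessel_integral lower_root l - of_real ?k * cis (l * s + pi / 8)) \<longlongrightarrow> 0) at_top"
    using bessel_integral_rotated[OF roots_polar(2) lower.sector_axioms]
    by (simp add: lower_root_def s_def add.commute)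
  have two: "((\<lambda>l. 2 * (?g l * bessel_integral 2 l)) \<longlongrightarrow> 0) at_top"
  proof -
    have "((\<lambda>l. exp (- (2 - s) * l)) \<longlongrightarrow> 0) at_top"
      using s by real_asymp
    then have "((\<lambda>l. 2 * (complex_of_real (exp (- (2 - s) * l))
        * (of_real (sqrt l) * exp (of_real l * 2) * bessel_integral 2 l))) \<longlongrightarrow>
        2 * (of_real 0 * (of_real (sqrt pi) / csqrt (1 / (2 * 2)) / 2))) at_top"
      by (intro tendsto_intros two.bessel_integral_asymptotics)
    moreover have "complex_of_real (exp (- (2 - s) * l)) * (of_real (sqrt l) * exp (of_real l * 2) * X)
        = ?g l * X" for l X
    proof -
      have "exp (- (2 - s) * l) * exp (l * 2) = exp (l * s)"
        unfolding exp_add[symmetric] by (simp add: algebra_simps)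
      then have "complex_of_real (exp (- (2 - s) * l)) * exp (of_real l * 2) = of_real (exp (l * s))"
        by (metis exp_of_real of_real_mult of_real_numeral)
      then show ?thesis by (simp add: mult_ac)
    qed
    ultimately show ?thesis by (simp only: of_real_0 mult_zero_left mult_zero_right)
  qed
  obtain C where C: "\<And>l. 1 \<le> l \<Longrightarrow> norm (S_star l - ?B l) \<le> C * exp (- (3 / 2 * l))"
    by (rule S_star_bessel) (rule that)
  have rest: "((\<lambda>l. ?g l * (S_star l - ?B l)) \<longlongrightarrow> 0) at_top"
  proof (rule Lim_null_comparison)
    show "((\<lambda>l. sqrt l * exp (l * s) * (C * exp (- (3 / 2 * l)))) \<longlongrightarrow> 0) at_top"
      using s by real_asymp
    show "\<forall>\<^sub>F l in at_top. norm (?g l * (S_star l - ?B l)) \<le> sqrt l * exp (l * s) * (C * exp (- (3 / 2 * l)))"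
      using eventually_ge_at_top[of 1]
    proof eventually_elim
      case (elim l)
      then have "norm (?g l) = sqrt l * exp (l * s)" by (simp add: norm_mult)
      moreover have "norm (?g l) * norm (S_star l - ?B l) \<le> norm (?g l) * (C * exp (- (3 / 2 * l)))"
        using C[OF elim] by (rule mult_left_mono) simp
      ultimately show ?case by (simp only: norm_mult)
    qed
  qed
  have "((\<lambda>l. ?g l * (S_star l - ?B l)
      + (?g l * bessel_integral upper_root l - of_real ?k * cis (- (l * s + pi / 8)))
      + (?g l * bessel_integral lower_root l - of_real ?k * cis (l * s + pi / 8))
      - 2 * (?g l * bessel_integral 2 l)) \<longlongrightarrow> 0 + 0 + 0 - 0) at_top"
    by (intro tendsto_add tendsto_diff rest upper lower two)
  moreover have "\<forall>\<^sub>F l in at_top. ?g l * (S_star l - ?B l)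
      + (?g l * bessel_integral upper_root l - of_real ?k * cis (- (l * s + pi / 8)))
      + (?g l * bessel_integral lower_root l - of_real ?k * cis (l * s + pi / 8))
      - 2 * (?g l * bessel_integral 2 l)
      = (S_star l - complex_of_real (?main l)) / complex_of_real (l powr (-1/2) * exp (- l * sqrt (pi/2)))"
    using eventually_gt_at_top[of 0]
  proof eventually_elim
    case (elim l)
    have root: "sqrt (pi / 2) = s" by (simp add: s_def pole_height_def)
    have l: "l powr (1 / 2) = sqrt l" "l powr (-1/2) = 1 / sqrt l"
      using elim by (simp_all add: powr_half_sqrt powr_minus_divide)
    have cosine: "cis (- (l * s + pi / 8)) + cis (l * s + pi / 8) = of_real (2 * cos (l * s + pi / 8))"
    proof -
      have "cis (- w) + cis w = of_real (2 * cos w)" for w by (simp add: complex_eq_iff)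
      then show ?thesis .
    qed
    have const: "2 powr (3/2) * pi powr (1/4) = 2 * ?k"
    proof -
      have "pi powr (1/4) = sqrt (sqrt pi)"
        by (simp add: powr_powr flip: powr_half_sqrt)
      moreover have "(2::real) powr (3/2) = 2 * sqrt 2"
        using powr_add[of 2 1 "1 / 2 :: real"] by (simp add: powr_half_sqrt)
      ultimately show ?thesis by (simp add: real_sqrt_mult)
    qed
    have main: "sqrt l * exp (l * s) * ?main l = ?k * (2 * cos (l * s + pi / 8))"
      unfolding root l const using elim by (simp add: exp_minus field_simps)
    have "?g l * (S_star l - ?B l)
      + (?g l * bessel_integral upper_root l - of_real ?k * cis (- (l * s + pi / 8)))
      + (?g l * bessel_integral lower_root l - of_real ?k * cis (l * s + pi / 8))
      - 2 * (?g l * bessel_integral 2 l)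
      = ?g l * S_star l - of_real ?k * (cis (- (l * s + pi / 8)) + cis (l * s + pi / 8))"
      by (simp add: algebra_simps)
    also have "\<dots> = ?g l * (S_star l - of_real (?main l))"
      unfolding cosine right_diff_distrib of_real_mult[symmetric] main ..
    also have "\<dots> = (S_star l - complex_of_real (?main l)) / complex_of_real (l powr (-1/2) * exp (- l * sqrt (pi/2)))"
    proof -
      have "l powr (-1/2) * exp (- l * sqrt (pi/2)) = inverse (sqrt l * exp (l * s))"
        unfolding root l by (simp add: exp_minus divide_inverse)
      then show ?thesis by (simp only: of_real_inverse divide_inverse inverse_inverse_eq mult.commute)
    qed
    finally show ?case .
  qed
  ultimately show "((\<lambda>l. (S_star l - complex_of_real (?main l))
      / complex_of_real (l powr (-1/2) * exp (- l * sqrt (pi/2)))) \<longlongrightarrow> 0) at_top"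
    by (simp only: add_0 diff_zero) (rule Lim_transform_eventually)
  show "\<forall>\<^sub>F l in at_top. complex_of_real (l powr (-1/2) * exp (- l * sqrt (pi/2))) \<noteq> 0"
    using eventually_gt_at_top[of 0] by eventually_elim simp
qed

end
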